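(* Let $\mathfrak H,\mathfrak M,\mathfrak N$ be separable Hilbert spaces, let $$T=\begin{pmatrix}A&B\\ C&D\end{pmatrix}=\begin{pmatrix}-FD^*G+D_{F^*}LD_G&FD_D\\ D_{D^*}G&D\end{pmatrix}:\mathfrak H\oplus\mathfrak M\to\mathfrak H\oplus\mathfrak N$$ be a contraction and let $Q=\begin{pmatrix}D_{F^*}LD_G&F\\ G&0\end{pmatrix}:\mathfrak H\oplus\mathfrak D_D\to\mathfrak H\oplus\mathfrak D_{D^*}$; put $S=D_{F^*}LD_G$. Then the following equations are equivalent on the operator interval $(0,I_{\mathfrak H}]$: (a) $X-A^*XA-C^*C-(A^*XB+C^*D)(I_{\mathfrak M}-B^*XB-D^*D)^{-1}(B^*XA+D^*C)=0$; (b) $(I_{\mathfrak H}-X)P_{\mathfrak H}=\left(D_T^2+T^*(I_{\mathfrak H}-X)P'_{\mathfrak H}T\right)_{\mathfrak H}$; (c) $(I_{\mathfrak H}-X)P_{\mathfrak H}=\left(D_Q^2+Q^*(I_{\mathfrak H}-X)P'_{\mathfrak H}Q\right)_{\mathfrak H}$; (d) $X-G^*G-S^*XS-S^*XF(I_{\mathfrak D_D}-F^*XF)^{-1}F^*XS=0$; (e) $X=G^*G+S^*X^{1/2}(I_{\mathfrak H}-X^{1/2}FF^*X^{1/2})^{-1}X^{1/2}S$. Moreover, equations (b)–(e) are equivalent to the equation $$\inf_{u\in\mathfrak M}\left\{\left\|\begin{pmatrix}X^{1/2}&0\\ 0&I_{\mathfrak M}\end{pmatrix}\begin{pmatrix}x\\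 u\end{pmatrix}\right\|^2-\left\|\begin{pmatrix}X^{1/2}&0\\ 0&I_{\mathfrak N}\end{pmatrix}T\begin{pmatrix}x\\ u\end{pmatrix}\right\|^2\right\}=0\quad\text{for all }x\in\mathfrak H .$$
   Context: Hilbert spaces are complex; $\mathbf L(\cdot,\cdot)$ denotes bounded operators. For a contraction $T$, $D_T=(I-T^*T)^{1/2}$, $\mathfrak D_T=\overline{\mathrm{ran}}\,D_T$. $X\in(0,I_{\mathfrak H}]$ means $X$ is a nonnegative selfadjoint contraction in $\mathfrak H$ with $\ker X=\{0\}$. Parametrization (known): every contraction $T=\begin{pmatrix}A&B\\ C&D\end{pmatrix}$ has the displayed form with (unique) contractions $F\in\mathbf L(\mathfrak D_D,\mathfrak H)$, $G\in\mathbf L(\mathfrak H,\mathfrak D_{D^*})$, $L\in\mathbf L(\mathfrak D_G,\mathfrak D_{F^*})$. Shorted operator: for bounded $S\ge0$ in $\mathcal H$ and a closed subspace $\mathcal K$, $S_{\mathcal K}=\max\{Z:\ 0\le Z\le S,\ \mathrm{ran}\,Z\subseteq\mathcal K\}$. $P_{\mathfrak H}$ is the orthogonal projection onto $\mathfrak H$ in the domain space ($\mathfrak H\oplus\mathfrak M$ in (b), $\mathfrak H\oplus\mathfrak D_D$ in (c)); $P'_{\mathfrak H}$ is the orthogonal projection onto $\mathfrak H$ in the target space ($\mathfrak H\oplus\mathfrak N$ in (b), $\mathfrak H\oplus\mathfrak D_{D^*}$ in (c)). Inverses: $R^{-1/2}$ is the Moore–Penrose inverse of $R^{1/2}$ for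 $R\ge0$, and expressions of the form $Y^*R^{-1}Y$ mean $(R^{-1/2}Y)^*(R^{-1/2}Y)$ (the needed range inclusions $\mathrm{ran}\,Y\subset\mathrm{ran}\,R^{1/2}$ hold for $0\le X\le I_{\mathfrak H}$). Thus $S^*XF(I_{\mathfrak D_D}-F^*XF)^{-1}F^*XS:=\left((I_{\mathfrak D_D}-F^*XF)^{-1/2}F^*XS\right)^*\left((I_{\mathfrak D_D}-F^*XF)^{-1/2}F^*XS\right)$, $S^*X^{1/2}(I_{\mathfrak H}-X^{1/2}FF^*X^{1/2})^{-1}X^{1/2}S:=D_GL^*R_1^*R_1LD_G$ with $R_1=(I_{\mathfrak H}-X^{1/2}FF^*X^{1/2})^{-1/2}X^{1/2}D_{F^*}$, and the last term in (a) is understood in the same way with $R=I_{\mathfrak M}-B^*XB-D^*D$, $Y=B^*XA+D^*C$. *)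

theory Defs
  imports "HOL-Analysis.Analysis"
begin

section \<open>Complex Hilbert spaces\<close>

text \<open>
  The inner product is linear in the first argument. Norm, metric and topology are the ones of
  the underlying real Hilbert space, whose inner product is the real part of the complex one.
\<close>

class chilbert_space = real_inner + complete_space +
  fixes scaleC :: "complex \<Rightarrow> 'a \<Rightarrow> 'a" (infixr "*\<^sub>C" 75)
    and cinner :: "'a \<Rightarrow> 'a \<Rightarrow> complex"
  assumes scaleC_add_right: "c *\<^sub>C (x + y) = c *\<^sub>C x + c *\<^sub>C y"
    and scaleC_add_left: "(c + d) *\<^sub>C x = c *\<^sub>C x + d *\<^sub>C x"
    and scaleC_scaleC: "c *\<^sub>C d *\<^sub>C x = (c * d) *\<^sub>C x"
    and scaleR_scaleC: "r *\<^sub>R x = complex_of_real r *\<^sub>C x"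
    and cinner_commute: "cinner x y = cnj (cinner y x)"
    and cinner_add_left: "cinner (x + y) z = cinner x z + cinner y z"
    and cinner_scaleC_left: "cinner (c *\<^sub>C x) y = c * cinner x y"
    and inner_eq_Re_cinner: "inner x y = Re (cinner x y)"

instantiation complex :: chilbert_space
begin

definition scaleC_complex :: "complex \<Rightarrow> complex \<Rightarrow> complex"
  where "scaleC_complex c x = c * x"

definition cinner_complex :: "complex \<Rightarrow> complex \<Rightarrow> complex"
  where "cinner_complex x y = x * cnj y"

instance
  by standard
    (simp_all add: scaleC_complex_def cinner_complex_def inner_complex_def scaleR_conv_of_real
      algebra_simps)

end

text \<open>The Hilbert space direct sum of two Hilbert spaces is their product type.\<close>

instantiation prod :: (chilbert_space, chilbert_space) chilbert_space
begin

definition scaleC_prod :: "complex \<Rightarrow> 'a \<times> 'b \<Rightarrow> 'a \<times> 'b"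
  where "scaleC_prod c x = (c *\<^sub>C fst x, c *\<^sub>C snd x)"

definition cinner_prod :: "'a \<times> 'b \<Rightarrow> 'a \<times> 'b \<Rightarrow> complex"
  where "cinner_prod x y = cinner (fst x) (fst y) + cinner (snd x) (snd y)"

instance
proof
  fix x y :: "'a \<times> 'b"
  have "cnj (cinner (fst y) (fst x)) = cinner (fst x) (fst y)"
    "cnj (cinner (snd y) (snd x)) = cinner (snd x) (snd y)"
    by (metis cinner_commute)+
  then show "cinner x y = cnj (cinner y x)"
    by (simp add: cinner_prod_def)
qed (simp_all add: scaleC_prod_def cinner_prod_def inner_prod_def scaleC_add_right
      scaleC_add_left scaleC_scaleC scaleR_scaleC cinner_add_left cinner_scaleC_left
      inner_eq_Re_cinner scaleR_prod_def prod_eq_iff algebra_simps)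

end

definition ortho :: "'a::chilbert_space set \<Rightarrow> 'a set"
  where "ortho K = {x. \<forall>y\<in>K. cinner x y = 0}"


section \<open>Bounded operators\<close>

text \<open>
  The type of real-linear bounded maps is used for all operators; complex linearity is a
  predicate. For closed subspaces \<open>K\<^sub>1\<close> and \<open>K\<^sub>2\<close>, an operator from \<open>K\<^sub>1\<close> to \<open>K\<^sub>2\<close> is represented by
  its extension by zero to the orthogonal complement of \<open>K\<^sub>1\<close>. This representation is isometric and
  compatible with sums, products and adjoints; the identity of \<open>K\<close> is represented by the orthogonal
  projection onto \<open>K\<close>.
\<close>

notation blinfun_compose (infixl "\<cdot>" 70)

definition ops :: "'a::chilbert_space set \<Rightarrow> 'b::chilbert_space set \<Rightarrow> ('a \<Rightarrow>\<^sub>L 'b) set"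
  where "ops K\<^sub>1 K\<^sub>2 =
    {T :: 'a \<Rightarrow>\<^sub>L 'b. (\<forall>c x. T (c *\<^sub>C x) = c *\<^sub>C T x) \<and> (\<forall>x\<in>ortho K\<^sub>1. T x = 0) \<and> range T \<subseteq> K\<^sub>2}"

definition proj :: "'a::chilbert_space set \<Rightarrow> 'a \<Rightarrow>\<^sub>L 'a"
  where "proj K = (THE P :: 'a \<Rightarrow>\<^sub>L 'a. \<forall>x. P x \<in> K \<and> x - P x \<in> ortho K)"

definition adj :: "('a::chilbert_space \<Rightarrow>\<^sub>L 'b::chilbert_space) \<Rightarrow> 'b \<Rightarrow>\<^sub>L 'a"
    ("_\<^sup>\<dagger>" [1000] 999)
  where "T\<^sup>\<dagger> = (THE T' :: 'b \<Rightarrow>\<^sub>L 'a. \<forall>x y. cinner (T x) y = cinner x (T' y))"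

definition nonneg_op :: "('a::chilbert_space \<Rightarrow>\<^sub>L 'a) \<Rightarrow> bool"
  where "nonneg_op R \<longleftrightarrow> R \<in> ops UNIV UNIV \<and> R\<^sup>\<dagger> = R \<and> (\<forall>x. 0 \<le> Re (cinner (R x) x))"

definition op_le :: "('a::chilbert_space \<Rightarrow>\<^sub>L 'a) \<Rightarrow> ('a \<Rightarrow>\<^sub>L 'a) \<Rightarrow> bool"
  where "op_le R S \<longleftrightarrow> nonneg_op (S - R)"

definition op_sqrt :: "('a::chilbert_space \<Rightarrow>\<^sub>L 'a) \<Rightarrow> 'a \<Rightarrow>\<^sub>L 'a"
  where "op_sqrt R = (THE S. nonneg_op S \<and> S \<cdot> S = R)"

text \<open>
  The operator interval from \<open>0\<close>, excluded in the sense of trivial kernel, to the identity.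
\<close>

definition op_interval :: "('a::chilbert_space \<Rightarrow>\<^sub>L 'a) set"
  where "op_interval = {X :: 'a \<Rightarrow>\<^sub>L 'a. nonneg_op X \<and> norm X \<le> 1 \<and> {x. X x = 0} = {0}}"

text \<open>
  The defect operator and the defect space of a contraction whose domain is the closed
  subspace \<open>K\<close>.
\<close>

definition defect_op ::
  "'a::chilbert_space set \<Rightarrow> ('a \<Rightarrow>\<^sub>L 'b::chilbert_space) \<Rightarrow> 'a \<Rightarrow>\<^sub>L 'a"
  where "defect_op K T = op_sqrt (proj K - T\<^sup>\<dagger> \<cdot> T)"

definition defect_space ::
  "'a::chilbert_space set \<Rightarrow> ('a \<Rightarrow>\<^sub>L 'b::chilbert_space) \<Rightarrow> 'a set"
  where "defect_space K T = closure (range (defect_op K T))"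

text \<open>
  The Moore--Penrose inverse need not be bounded. It is meaningful on the sum of the range of \<open>R\<close>
  and the orthogonal complement of that range, and unspecified elsewhere.
\<close>

definition mp_inv :: "('a::chilbert_space \<Rightarrow>\<^sub>L 'b::chilbert_space) \<Rightarrow> 'b \<Rightarrow> 'a"
  where "mp_inv R y = (THE x. x \<in> ortho {z. R z = 0} \<and> y - R x \<in> ortho (range R))"

text \<open>
  The product \<open>R\<^sup>-\<^sup>1\<^sup>/\<^sup>2 Y\<close>, which is a bounded operator if the range of \<open>Y\<close> is contained in that of
  the square root of \<open>R\<close>.
\<close>

definition inv_sqrt_comp ::
  "('b::chilbert_space \<Rightarrow>\<^sub>L 'b) \<Rightarrow> ('a::chilbert_space \<Rightarrow>\<^sub>L 'b) \<Rightarrow> 'a \<Rightarrow>\<^sub>L 'b"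
  where "inv_sqrt_comp R Y = Blinfun (\<lambda>x. mp_inv (op_sqrt R) (Y x))"

text \<open>The product \<open>Y\<^sup>* R\<^sup>-\<^sup>1 Y\<close>, understood as \<open>(R\<^sup>-\<^sup>1\<^sup>/\<^sup>2 Y)\<^sup>* (R\<^sup>-\<^sup>1\<^sup>/\<^sup>2 Y)\<close>.\<close>

definition inv_sandwich ::
  "('b::chilbert_space \<Rightarrow>\<^sub>L 'b) \<Rightarrow> ('a::chilbert_space \<Rightarrow>\<^sub>L 'b) \<Rightarrow> 'a \<Rightarrow>\<^sub>L 'a"
  where "inv_sandwich R Y = (inv_sqrt_comp R Y)\<^sup>\<dagger> \<cdot> inv_sqrt_comp R Y"

definition shorted :: "('a::chilbert_space \<Rightarrow>\<^sub>L 'a) \<Rightarrow> 'a set \<Rightarrow> 'a \<Rightarrow>\<^sub>L 'a"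
  where "shorted S K =
    (let \<Z> = {Z :: 'a \<Rightarrow>\<^sub>L 'a. op_le 0 Z \<and> op_le Z S \<and> range Z \<subseteq> K}
     in THE Z. Z \<in> \<Z> \<and> (\<forall>Z'\<in>\<Z>. op_le Z' Z))"

lift_definition block ::
  "('h::chilbert_space \<Rightarrow>\<^sub>L 'k::chilbert_space) \<Rightarrow> ('m::chilbert_space \<Rightarrow>\<^sub>L 'k) \<Rightarrow>
   ('h \<Rightarrow>\<^sub>L 'n::chilbert_space) \<Rightarrow> ('m \<Rightarrow>\<^sub>L 'n) \<Rightarrow> ('h \<times> 'm) \<Rightarrow>\<^sub>L ('k \<times> 'n)"
  is "\<lambda>A B C D z. (A (fst z) + B (snd z), C (fst z) + D (snd z))"
  by (intro bounded_linear_Pair bounded_linear_add;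
      erule bounded_linear_compose;
      rule bounded_linear_fst bounded_linear_snd)

text \<open>
  For \<open>Y\<close> on the first summand: \<open>Y P\<close>, where \<open>P\<close> is the orthogonal projection onto the first summand,
  regarded as an operator on the direct sum.
\<close>

definition on_fst :: "('h::chilbert_space \<Rightarrow>\<^sub>L 'h) \<Rightarrow> ('h \<times> 'm::chilbert_space) \<Rightarrow>\<^sub>L ('h \<times> 'm)"
  where "on_fst Y = block Y 0 0 0"

end

theory Submission
  imports Defs
begin

text \<open>
  All six equations say that \<open>I - X\<close> is the Schur complement of the quadratic form
  \<open>\<parallel>x\<parallel>\<^sup>2 + \<parallel>u\<parallel>\<^sup>2 - \<parallel>X\<^sup>1\<^sup>/\<^sup>2 (A x + B u)\<parallel>\<^sup>2 - \<parallel>C x + D u\<parallel>\<^sup>2\<close>, that is, its infimum over \<open>u\<close>. The shorted operator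
  of a nonnegative operator is its Schur complement, and so is the expression with the Moore--Penrose
  inverse, because \<open>\<parallel>R\<^sup>-\<^sup>1\<^sup>/\<^sup>2 Y x\<parallel>\<^sup>2\<close> is the supremum of \<open>2 Re \<langle>Y x, u\<rangle> - \<langle>R u, u\<rangle>\<close>. To pass from \<open>T\<close> to \<open>Q\<close>,
  substitute \<open>v = D\<^sub>D u - D\<^sup>* G x\<close>, which runs through a dense subset of the defect space of \<open>D\<close>:
  the Julia operator of \<open>D\<close> is isometric, so the substitution turns the form of \<open>T\<close> into that of \<open>Q\<close>.
\<close>

section \<open>Projections and representation of functionals\<close>

text \<open>Each expression is therefore accessed only through its bounds: a Schur complement
  through the \<open>r\<close> that stay below the form for every \<open>u\<close>, a squared norm
  dually through its upper bounds. Values with the same bounds coincide, and symmetric operators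
  with the same quadratic form are equal. The range inclusion behind each
  \<open>inv_sandwich\<close> need not be checked by hand: a nonnegative block form satisfies a
  Cauchy-Schwarz inequality, and its off-diagonal instance is Douglas' bound. Nonnegativity itself
  comes from 0 <= X <= I and the contractivity of T, and it passes to Q with the substitution.
  Equations (d) and (e) contain inverses on different spaces. Formally they are linked by X^{1/2} (I
  - Z Z')^{-1} X^{1/2} = X + X F (I - Z' Z)^{-1} F' X with Z = X^{1/2} F, a prime denoting the
  adjoint; the rigorous version exchanges two suprema. Proofs use the real inner product, since a
  complex-linear operator has the same adjoint for it as for the complex one.\<close>

lemma norm_add_sq: "(norm (a + b))\<^sup>2 = (norm a)\<^sup>2 + (norm b)\<^sup>2 + 2 * inner a (b :: 'a::real_inner)"
  by (simp add: power2_norm_eq_inner inner_add_left inner_add_right inner_commute[of b a])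

lemma norm_diff_sq: "(norm (a - b))\<^sup>2 = (norm a)\<^sup>2 + (norm b)\<^sup>2 - 2 * inner a (b :: 'a::real_inner)"
  by (simp add: power2_norm_eq_inner inner_diff_left inner_diff_right inner_commute[of b a])

lemma subspace_closure:
  fixes K :: "'a::real_normed_vector set"
  assumes "subspace K"
  shows "subspace (closure K)"
proof (rule subspaceI)
  show "0 \<in> closure K"
    using subspace_0[OF assms] closure_subset by blast
  show "x + y \<in> closure K" if xy: "x \<in> closure K" "y \<in> closure K" for x y
  proof -
    obtain f g where "\<And>n. f n \<in> K" "f \<longlonglongrightarrow> x" "\<And>n. g n \<in> K" "g \<longlonglongrightarrow> y"
      using xy unfolding closure_sequential by blast
    then have "\<And>n. f n + g n \<in> K" "(\<lambda>n. f n + g n) \<longlonglongrightarrow> x + y"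
      using assms by (auto intro: subspace_add tendsto_add)
    then show ?thesis unfolding closure_sequential by (intro exI[of _ "\<lambda>n. f n + g n"]) blast
  qed
  show "c *\<^sub>R x \<in> closure K" if x: "x \<in> closure K" for c x
  proof -
    obtain f where "\<And>n. f n \<in> K" "f \<longlonglongrightarrow> x"
      using x unfolding closure_sequential by blast
    then have "\<And>n. c *\<^sub>R f n \<in> K" "(\<lambda>n. c *\<^sub>R f n) \<longlonglongrightarrow> c *\<^sub>R x"
      using assms by (auto intro: subspace_scale tendsto_scaleR)
    then show ?thesis unfolding closure_sequential by (intro exI[of _ "\<lambda>n. c *\<^sub>R f n"]) blast
  qed
qed

lemma Cauchy_of_sq_dist:
  fixes f :: "nat \<Rightarrow> 'a::real_normed_vector"
  assumes "\<And>m n. (norm (f m - f n))\<^sup>2 \<le> e m + e n" "e \<longlonglongrightarrow> (0::real)"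
  shows "Cauchy f"
proof (rule CauchyI)
  fix r :: real assume "0 < r"
  then have "\<forall>\<^sub>F n in sequentially. e n < r\<^sup>2 / 2"
    using assms(2) by (intro order_tendstoD) auto
  then obtain M where M: "\<And>n. n \<ge> M \<Longrightarrow> e n < r\<^sup>2 / 2"
    by (auto simp: eventually_sequentially)
  have "norm (f m - f n) < r" if "m \<ge> M" "n \<ge> M" for m n
  proof -
    have "(norm (f m - f n))\<^sup>2 < r\<^sup>2"
      using assms(1)[of m n] M[OF that(1)] M[OF that(2)] by simp
    then show ?thesis
      using \<open>0 < r\<close> by (simp add: power_less_imp_less_base)
  qed
  then show "\<exists>M. \<forall>m\<ge>M. \<forall>n\<ge>M. norm (f m - f n) < r" by blast
qed

lemma nearest_point_exists:
  fixes K :: "'a::{real_inner,complete_space} set"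
  assumes "closed K" "convex K" "K \<noteq> {}"
  shows "\<exists>p\<in>K. \<forall>y\<in>K. norm (x - p) \<le> norm (x - y)"
proof -
  define d where "d = (INF y\<in>K. (norm (x - y))\<^sup>2)"
  have bdd: "bdd_below ((\<lambda>y. (norm (x - y))\<^sup>2) ` K)"
    by (rule bdd_belowI[of _ 0]) auto
  have d_le: "d \<le> (norm (x - y))\<^sup>2" if "y \<in> K" for y
    unfolding d_def using bdd that by (rule cINF_lower)
  have "\<exists>y\<in>K. (norm (x - y))\<^sup>2 < d + 1 / real (Suc n)" for n
    using cINF_less_iff[OF assms(3) bdd, of "d + 1 / real (Suc n)"] by (simp add: d_def)
  then obtain f where f: "\<And>n. f n \<in> K" "\<And>n. (norm (x - f n))\<^sup>2 < d + 1 / real (Suc n)"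
    by metis
  have "(norm (f m - f n))\<^sup>2 \<le> 2 / real (Suc m) + 2 / real (Suc n)" for m n
  proof -
    \<comment> \<open>Parallelogram law for \<open>x - f m\<close> and \<open>x - f n\<close>: the
      midpoint stays in \<open>K\<close>, so the sum of the two vectors has squared norm at least
      \<open>4 * d\<close>, which leaves only the two excesses for the difference.\<close>
    have "(1/2) *\<^sub>R f m + (1/2) *\<^sub>R f n \<in> K"
      using assms(2) f(1) by (auto simp: convex_def)
    from d_le[OF this]
    have "4 * d \<le> (norm (2 *\<^sub>R x - f m - f n))\<^sup>2"
      by (simp add: power2_norm_eq_inner inner_simps algebra_simps)
    moreover have "(norm (f m - f n))\<^sup>2 + (norm (2 *\<^sub>R x - f m - f n))\<^sup>2
        = 2 * (norm (x - f m))\<^sup>2 + 2 * (norm (x - f n))\<^sup>2"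
      by (simp add: power2_norm_eq_inner inner_simps inner_commute algebra_simps)
    ultimately show ?thesis
      using f(2)[of m] f(2)[of n] by simp
  qed
  moreover have "(\<lambda>n. 2 / real (Suc n)) \<longlonglongrightarrow> 0"
    using tendsto_mult[OF tendsto_const[of 2] LIMSEQ_inverse_real_of_nat] by (simp add: field_simps)
  ultimately have "Cauchy f" by (rule Cauchy_of_sq_dist)
  then obtain p where p: "f \<longlonglongrightarrow> p"
    using Cauchy_convergent_iff convergent_def by blast
  have "p \<in> K" using closed_sequentially[OF assms(1)] f(1) p by blast
  have "(\<lambda>n. d + 1 / real (Suc n)) \<longlonglongrightarrow> d + 0"
    using LIMSEQ_inverse_real_of_nat by (intro tendsto_add tendsto_const) (simp add: field_simps)
  moreover have "(\<lambda>n. (norm (x - f n))\<^sup>2) \<longlonglongrightarrow> (norm (x - p))\<^sup>2"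
    by (intro tendsto_intros p)
  ultimately have "(norm (x - p))\<^sup>2 \<le> d + 0"
    using f(2) by (intro LIMSEQ_le) (auto intro: less_imp_le)
  then have "(norm (x - p))\<^sup>2 \<le> (norm (x - y))\<^sup>2" if "y \<in> K" for y
    using d_le[OF that] by linarith
  then have "norm (x - p) \<le> norm (x - y)" if "y \<in> K" for y
    using that by (meson norm_ge_zero power2_le_imp_le)
  then show ?thesis using \<open>p \<in> K\<close> by blast
qed

lemma orthogonal_decomposition_exists:
  fixes K :: "'a::{real_inner,complete_space} set"
  assumes "closed K" "subspace K"
  shows "\<exists>p\<in>K. \<forall>y\<in>K. inner (x - p) y = 0"
proof -
  have "K \<noteq> {}" using assms(2) subspace_0 by auto
  then obtain p where p: "p \<in> K" "\<And>y. y \<in> K \<Longrightarrow> norm (x - p) \<le> norm (x - y)"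
    using nearest_point_exists[OF assms(1) subspace_imp_convex[OF assms(2)]] by metis
  have "inner (x - p) y = 0" if "y \<in> K" for y
  proof (cases "y = 0")
    case False
    \<comment> \<open>\<open>t\<close> minimizes the squared norm of
      \<open>(x - p) - t *\<^sub>R y\<close>; any nonzero correlation with \<open>y\<close> would
      give a point nearer than \<open>p\<close>.\<close>
    define t where "t = inner (x - p) y / inner y y"
    have yy: "inner y y > 0" using False by simp
    have "p + t *\<^sub>R y \<in> K"
      using assms(2) p(1) that by (simp add: subspace_add subspace_scale)
    then have "(norm (x - p))\<^sup>2 \<le> (norm ((x - p) - t *\<^sub>R y))\<^sup>2"
      using p(2)[of "p + t *\<^sub>R y"] by (intro power_mono) (auto simp: algebra_simps)
    also have "\<dots> = (norm (x - p))\<^sup>2 - 2 * t * inner (x - p) y + t\<^sup>2 * inner y y"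
      unfolding power2_norm_eq_inner
      by (simp add: inner_diff_left inner_diff_right inner_commute[of y x] inner_commute[of y p]
          power2_eq_square algebra_simps)
    also have "\<dots> = (norm (x - p))\<^sup>2 - (inner (x - p) y)\<^sup>2 / inner y y"
      using yy by (simp add: t_def field_simps power2_eq_square)
    finally have "(inner (x - p) y)\<^sup>2 / inner y y \<le> 0" by simp
    then show ?thesis using yy by (simp add: divide_le_0_iff)
  qed simp
  then show ?thesis using p(1) by blast
qed

text \<open>
  The orthogonal projection of \<open>(0, 1)\<close> onto the closure of \<open>{(S u, f u)}\<close> carries the representing
  vector. The case \<open>S = id\<close> is the Riesz theorem; for a positive square root \<open>S\<close> it is Douglas'
  range inclusion.
\<close>

lemma functional_factorization:
  fixes S :: "'a::real_vector \<Rightarrow> 'b::{real_inner,complete_space}" and f :: "'a \<Rightarrow> real"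
  assumes "linear S" "linear f" "\<And>u. \<bar>f u\<bar> \<le> c * norm (S u)"
  shows "\<exists>w\<in>closure (range S). \<forall>u. f u = inner w (S u)"
proof -
  interpret S: linear S by fact
  interpret f: linear f by fact
  define W where "W = closure (range (\<lambda>u. (S u, f u)))"
  have "linear (\<lambda>u. (S u, f u))"
    by (rule linearI) (simp_all add: S.add f.add S.scale f.scale)
  then have "subspace (range (\<lambda>u. (S u, f u)))"
    using linear_subspace_image subspace_UNIV by blast
  then have sub: "subspace W" by (simp add: W_def subspace_closure)
  have "closed W" by (simp add: W_def)
  from orthogonal_decomposition_exists[OF this sub, of "(0, 1)"]
  obtain p where "p \<in> W" and "\<forall>y\<in>W. inner ((0, 1) - p) y = 0" by blast
  moreover obtain w t where "p = (w, t)" by fastforce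
  ultimately have wt: "(w, t) \<in> W" and orth: "\<And>y. y \<in> W \<Longrightarrow> inner ((0, 1) - (w, t)) y = 0"
    by auto
  have "inner (- w, 1 - t) (S u, f u) = 0" for u
    using orth[of "(S u, f u)"] closure_subset[of "range (\<lambda>u. (S u, f u))"] by (auto simp: W_def)
  then have eq: "inner w (S u) = (1 - t) * f u" for u
    by simp
  have w: "w \<in> closure (range S)"
  proof -
    have "W \<subseteq> closure (range S \<times> UNIV)"
      unfolding W_def by (rule closure_mono) auto
    then show ?thesis using wt by (auto simp: closure_Times)
  qed
  \<comment> \<open>The estimate on \<open>f\<close> is a closed condition on pairs, so it survives
    the closure. It keeps \<open>W\<close> from containing a vertical vector \<open>(0, t)\<close>
    with nonzero \<open>t\<close>, which is what excludes \<open>t = 1\<close> below.\<close>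
  have bound: "\<bar>snd z\<bar> \<le> c * norm (fst z)" if "z \<in> W" for z
  proof -
    have "closed {z :: 'b \<times> real. \<bar>snd z\<bar> \<le> c * norm (fst z)}"
      by (intro closed_Collect_le continuous_intros)
    then have "W \<subseteq> {z. \<bar>snd z\<bar> \<le> c * norm (fst z)}"
      unfolding W_def using assms(3) by (intro closure_minimal) auto
    with that show ?thesis by auto
  qed
  have "t \<noteq> 1"
  proof
    assume "t = 1"
    then have "range S \<subseteq> {y. inner w y = 0}" using eq by auto
    then have "closure (range S) \<subseteq> {y. inner w y = 0}"
      by (intro closure_minimal closed_Collect_eq continuous_intros)
    with w have "w = 0" by auto
    with bound[OF wt] \<open>t = 1\<close> show False by simp
  qed
  have "w /\<^sub>R (1 - t) \<in> closure (range S)"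
    using subspace_scale[OF subspace_closure[OF linear_subspace_image[OF assms(1) subspace_UNIV]] w] .
  moreover have "f u = inner (w /\<^sub>R (1 - t)) (S u)" for u
    using eq[of u] \<open>t \<noteq> 1\<close> by simp
  ultimately show ?thesis by blast
qed


section \<open>Operators on complex Hilbert spaces\<close>

lemma cinner_scaleC_right: "cinner x (c *\<^sub>C y) = cnj c * cinner x y"
  by (metis cinner_commute cinner_scaleC_left complex_cnj_mult)

text \<open>The imaginary part is the real part after a rotation of the second argument by \<i>.
  Hence facts about the complex inner product reduce to real ones for everything compatible with
  complex scalars.\<close>

lemma cinner_eq_inner: "cinner x y = Complex (inner x y) (inner x (\<i> *\<^sub>C y))"
  by (simp add: complex_eq_iff inner_eq_Re_cinner cinner_scaleC_right)

lemma inner_scaleC_left: "inner (c *\<^sub>C x) y = inner x (cnj c *\<^sub>C y)"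
  by (simp add: inner_eq_Re_cinner cinner_scaleC_right cinner_scaleC_left)

lemma norm_scaleC: "norm (c *\<^sub>C (x::'a::chilbert_space)) = cmod c * norm x"
proof -
  have "complex_of_real ((cmod c)\<^sup>2) = cnj c * c"
    using complex_norm_square[of c] by (simp add: mult.commute)
  then have "cnj c *\<^sub>C c *\<^sub>C x = (cmod c)\<^sup>2 *\<^sub>R x"
    by (simp add: scaleC_scaleC scaleR_scaleC)
  then have "(norm (c *\<^sub>C x))\<^sup>2 = (cmod c * norm x)\<^sup>2"
    by (simp add: power2_norm_eq_inner inner_scaleC_left power_mult_distrib)
  then show ?thesis by (simp add: power2_eq_iff_nonneg)
qed

lemma bounded_linear_scaleC: "bounded_linear (\<lambda>x::'a::chilbert_space. c *\<^sub>C x)"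
  by (rule bounded_linear_intro[where K = "cmod c"])
    (simp_all add: scaleC_add_right scaleR_scaleC scaleC_scaleC norm_scaleC mult.commute)

lemma in_ortho_iff_inner:
  assumes "\<And>c y. y \<in> K \<Longrightarrow> c *\<^sub>C y \<in> K"
  shows "x \<in> ortho K \<longleftrightarrow> (\<forall>y\<in>K. inner x y = 0)"
  using assms by (auto simp: ortho_def cinner_eq_inner complex_eq_iff)

lemma ortho_UNIV: "ortho UNIV = {0}"
  using in_ortho_iff_inner[of UNIV] inner_eq_zero_iff by auto

lemma ops_UNIV_iff: "T \<in> ops UNIV UNIV \<longleftrightarrow> (\<forall>c x. T (c *\<^sub>C x) = c *\<^sub>C T x)"
  by (auto simp: ops_def ortho_UNIV)

lemma ops_scaleC: "T \<in> ops K K' \<Longrightarrow> T (c *\<^sub>C x) = c *\<^sub>C T x"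
  by (simp add: ops_def)

text \<open>Only complex linearity is kept from here on. The support of \<open>F\<close> and the
  range of \<open>G\<close> return in \<open>ops_apply_proj\<close> and
  \<open>adj_D_G_in_DD\<close>.\<close>

lemma ops_imp_ops_UNIV: "T \<in> ops K K' \<Longrightarrow> T \<in> ops UNIV UNIV"
  by (simp add: ops_UNIV_iff ops_scaleC)

lemma scaleC_minus_right: "c *\<^sub>C (- x) = - (c *\<^sub>C (x::'a::chilbert_space))"
  using bounded_linear.linear[OF bounded_linear_scaleC] by (rule linear_neg)

lemma scaleC_diff_right: "c *\<^sub>C (x - y) = c *\<^sub>C x - c *\<^sub>C (y::'a::chilbert_space)"
  using bounded_linear.linear[OF bounded_linear_scaleC] by (rule linear_diff)

lemma scaleC_zero_right: "c *\<^sub>C 0 = (0::'a::chilbert_space)"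
  using bounded_linear.linear[OF bounded_linear_scaleC] by (rule linear_0)

lemma scaleC_scaleR: "c *\<^sub>C r *\<^sub>R x = r *\<^sub>R c *\<^sub>C (x::'a::chilbert_space)"
  by (simp add: scaleR_scaleC scaleC_scaleC mult.commute)

lemma ops_UNIV_id: "id_blinfun \<in> ops UNIV UNIV"
  and ops_UNIV_zero: "0 \<in> ops UNIV UNIV"
  and ops_UNIV_add: "T \<in> ops UNIV UNIV \<Longrightarrow> T' \<in> ops UNIV UNIV \<Longrightarrow> T + T' \<in> ops UNIV UNIV"
  and ops_UNIV_diff: "T \<in> ops UNIV UNIV \<Longrightarrow> T' \<in> ops UNIV UNIV \<Longrightarrow> T - T' \<in> ops UNIV UNIV"
  and ops_UNIV_scaleR: "T \<in> ops UNIV UNIV \<Longrightarrow> r *\<^sub>R T \<in> ops UNIV UNIV"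
  and ops_UNIV_compose: "U \<in> ops UNIV UNIV \<Longrightarrow> T \<in> ops UNIV UNIV \<Longrightarrow> U \<cdot> T \<in> ops UNIV UNIV"
  and ops_UNIV_block: "A \<in> ops UNIV UNIV \<Longrightarrow> B \<in> ops UNIV UNIV \<Longrightarrow> C \<in> ops UNIV UNIV \<Longrightarrow>
    D \<in> ops UNIV UNIV \<Longrightarrow> block A B C D \<in> ops UNIV UNIV"
  by (auto simp: ops_UNIV_iff blinfun.bilinear_simps scaleC_add_right scaleC_diff_right
      scaleC_minus_right scaleC_zero_right scaleC_scaleR scaleC_prod_def block.rep_eq)

lemmas ops_UNIV_intros = ops_UNIV_id ops_UNIV_zero ops_UNIV_add ops_UNIV_diff
  ops_UNIV_scaleR ops_UNIV_compose ops_UNIV_block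

section \<open>Riesz representation and adjoints\<close>

lemma riesz_representation:
  fixes f :: "'a::{real_inner,complete_space} \<Rightarrow> real"
  assumes "bounded_linear f"
  shows "\<exists>w. \<forall>u. f u = inner w u"
proof -
  obtain c where "\<And>u. \<bar>f u\<bar> \<le> norm u * c"
    using bounded_linear.bounded[OF assms] by auto
  then show ?thesis
    using functional_factorization[of "\<lambda>u. u" f c] bounded_linear.linear[OF assms]
      bounded_linear.linear[OF bounded_linear_ident]
    by (auto simp: mult.commute)
qed

lemma real_adjoint_exists:
  fixes T :: "'a::{real_inner,complete_space} \<Rightarrow>\<^sub>L 'b::real_inner"
  shows "\<exists>T' :: 'b \<Rightarrow>\<^sub>L 'a. \<forall>x y. inner (T x) y = inner x (T' y)"
proof -
  have "bounded_linear (\<lambda>x. inner (T x) y)" for y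
    by (rule bounded_linear_compose[OF bounded_linear_inner_left]) (rule blinfun.bounded_linear_right)
  then have "\<exists>w. \<forall>x. inner (T x) y = inner w x" for y
    by (rule riesz_representation)
  then obtain g where g: "inner (T x) y = inner x (g y)" for x y
    by (metis inner_commute)
  have "bounded_linear g"
  proof (rule bounded_linear_intro[where K = "norm T"])
    have "inner x (g (y + z)) = inner x (g y + g z)" for x y z
      by (simp add: g[symmetric] inner_add_right)
    then show "g (y + z) = g y + g z" for y z
      by (metis vector_eq_rdot inner_commute)
    have "inner x (g (r *\<^sub>R y)) = inner x (r *\<^sub>R g y)" for x y r
      by (simp add: g[symmetric])
    then show "g (r *\<^sub>R y) = r *\<^sub>R g y" for y r
      by (metis vector_eq_rdot inner_commute)
    fix y
    have "(norm (g y))\<^sup>2 = inner (T (g y)) y"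
      by (simp add: power2_norm_eq_inner g)
    also have "\<dots> \<le> norm (T (g y)) * norm y"
      by (rule norm_cauchy_schwarz)
    also have "\<dots> \<le> norm T * norm (g y) * norm y"
      by (intro mult_right_mono norm_blinfun norm_ge_zero)
    finally have "norm (g y) * norm (g y) \<le> norm (g y) * (norm y * norm T)"
      by (simp add: power2_eq_square ac_simps)
    then show "norm (g y) \<le> norm y * norm T"
      by (cases "g y = 0") (auto simp: mult_le_cancel_left)
  qed
  then show ?thesis
    using g by (intro exI[of _ "Blinfun g"]) (simp add: bounded_linear_Blinfun_apply)
qed

text \<open>Nondegeneracy of the real inner product makes the real adjoint of a complex-linear
  operator complex-linear too, so it also satisfies the complex identity. Identifying an adjoint
  thus takes only a real computation.\<close>

lemma adj_eqI:
  fixes T :: "'a::chilbert_space \<Rightarrow>\<^sub>L 'b::chilbert_space" and T' :: "'b \<Rightarrow>\<^sub>L 'a"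
  assumes T: "T \<in> ops UNIV UNIV" and eq: "\<And>x y. inner (T x) y = inner x (T' y)"
  shows "T\<^sup>\<dagger> = T'"
proof -
  have T': "T' (c *\<^sub>C y) = c *\<^sub>C T' y" for c y
  proof -
    have "inner x (T' (c *\<^sub>C y)) = inner x (c *\<^sub>C T' y)" for x
      using T by (metis eq inner_scaleC_left complex_cnj_cnj ops_scaleC)
    then show ?thesis by (metis vector_eq_rdot inner_commute)
  qed
  have "\<forall>x y. cinner (T x) y = cinner x (T' y)"
    by (simp add: cinner_eq_inner eq T')
  moreover have "U = T'" if "\<forall>x y. cinner (T x) y = cinner x (U y)" for U :: "'b \<Rightarrow>\<^sub>L 'a"
  proof (rule blinfun_eqI)
    fix y
    have "inner x (U y) = inner x (T' y)" for x
      using that eq by (simp add: inner_eq_Re_cinner)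
    then show "U y = T' y" by (metis vector_eq_rdot inner_commute)
  qed
  ultimately show ?thesis
    unfolding adj_def by (rule the_equality)
qed

lemma inner_adj:
  assumes "T \<in> ops UNIV UNIV"
  shows "inner x ((T\<^sup>\<dagger>) y) = inner (T x) y" and "inner ((T\<^sup>\<dagger>) y) x = inner y (T x)"
  using real_adjoint_exists[of T] adj_eqI[OF assms] by (metis inner_commute)+

lemma ops_adj: "T\<^sup>\<dagger> \<in> ops UNIV UNIV" if T: "T \<in> ops UNIV UNIV"
  unfolding ops_UNIV_iff
proof (intro allI)
  fix c y
  have "inner ((T\<^sup>\<dagger>) (c *\<^sub>C y)) x = inner (c *\<^sub>C (T\<^sup>\<dagger>) y) x" for x
    by (simp add: inner_adj[OF T] inner_scaleC_left ops_scaleC[OF T])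
  then show "(T\<^sup>\<dagger>) (c *\<^sub>C y) = c *\<^sub>C (T\<^sup>\<dagger>) y" by (metis vector_eq_rdot)
qed

lemma adj_adj: "T \<in> ops UNIV UNIV \<Longrightarrow> (T\<^sup>\<dagger>)\<^sup>\<dagger> = T"
  by (rule adj_eqI) (simp_all add: ops_adj inner_adj)

lemma norm_adj_le: "norm (T\<^sup>\<dagger>) \<le> norm T" if T: "T \<in> ops UNIV UNIV"
proof (rule norm_blinfun_bound)
  fix y
  have "(norm ((T\<^sup>\<dagger>) y))\<^sup>2 = inner (T ((T\<^sup>\<dagger>) y)) y"
    by (simp add: power2_norm_eq_inner inner_adj[OF T])
  also have "\<dots> \<le> norm (T ((T\<^sup>\<dagger>) y)) * norm y"
    by (rule norm_cauchy_schwarz)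
  also have "\<dots> \<le> norm T * norm ((T\<^sup>\<dagger>) y) * norm y"
    by (intro mult_right_mono norm_blinfun norm_ge_zero)
  finally have "norm ((T\<^sup>\<dagger>) y) * norm ((T\<^sup>\<dagger>) y) \<le> norm ((T\<^sup>\<dagger>) y) * (norm T * norm y)"
    by (simp add: power2_eq_square ac_simps)
  then show "norm ((T\<^sup>\<dagger>) y) \<le> norm T * norm y"
    by (cases "(T\<^sup>\<dagger>) y = 0") (auto simp: mult_le_cancel_left)
qed simp

lemma norm_blinfun_le: "norm T \<le> 1 \<Longrightarrow> norm (blinfun_apply T x) \<le> norm x"
  using norm_blinfun[of T x] mult_right_mono[of "norm T" 1 "norm x"] by simp

section \<open>Symmetric operators and nonnegative quadratic forms\<close>

definition symm_op :: "('a::real_inner \<Rightarrow>\<^sub>L 'a) \<Rightarrow> bool"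
  where "symm_op R \<longleftrightarrow> (\<forall>x y. inner (R x) y = inner x (R y))"

lemma symm_opD: "symm_op R \<Longrightarrow> inner (R x) y = inner x (R y)"
  by (simp add: symm_op_def)

text \<open>By \<open>adj_eqI\<close>, self-adjointness of a complex-linear operator can be tested
  with the real inner product. In this form it passes to limits, sums and block operators without
  mention of adjoints.\<close>

lemma nonneg_op_iff:
  "nonneg_op R \<longleftrightarrow> R \<in> ops UNIV UNIV \<and> symm_op R \<and> (\<forall>x. 0 \<le> inner (R x) x)"
  unfolding nonneg_op_def symm_op_def inner_eq_Re_cinner[symmetric]
  by (metis adj_eqI inner_adj(1))

lemma nonneg_opD:
  assumes "nonneg_op R"
  shows "R \<in> ops UNIV UNIV" "symm_op R" "0 \<le> inner (R x) x"
  using assms by (auto simp: nonneg_op_iff)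

lemma symm_opD': "symm_op R \<Longrightarrow> inner (R x) y = inner (R y) x"
  using symm_opD[of R x y] inner_commute[of x "R y"] by simp

lemma symm_op_intros:
  fixes R R' :: "'a::real_inner \<Rightarrow>\<^sub>L 'a"
  shows "symm_op 0" "symm_op id_blinfun"
    "symm_op R \<Longrightarrow> symm_op R' \<Longrightarrow> symm_op (R + R')"
    "symm_op R \<Longrightarrow> symm_op R' \<Longrightarrow> symm_op (R - R')"
    "symm_op R \<Longrightarrow> symm_op (r *\<^sub>R R)"
    "symm_op R \<Longrightarrow> symm_op (R \<cdot> R)"
  by (simp_all add: symm_op_def blinfun.bilinear_simps inner_simps)

lemma symm_op_sandwich:
  assumes "T \<in> ops UNIV UNIV"
  shows "symm_op X \<Longrightarrow> symm_op (T\<^sup>\<dagger> \<cdot> X \<cdot> T)" "symm_op (T\<^sup>\<dagger> \<cdot> T)" "symm_op (T \<cdot> T\<^sup>\<dagger>)"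
proof -
  show "symm_op X \<Longrightarrow> symm_op (T\<^sup>\<dagger> \<cdot> X \<cdot> T)" "symm_op (T\<^sup>\<dagger> \<cdot> T)"
    using assms by (simp_all add: symm_op_def inner_adj)
  show "symm_op (T \<cdot> T\<^sup>\<dagger>)"
    by (simp add: symm_op_def flip: inner_adj[OF assms])
qed

lemma symm_op_block: "symm_op P \<Longrightarrow> symm_op R \<Longrightarrow> symm_op (block P 0 0 R)"
  by (simp add: symm_op_def block.rep_eq inner_prod_def)

text \<open>Polarization. Through it the operator equations below become comparisons of real
  numbers.\<close>

lemma symm_op_eqI:
  assumes "symm_op P" "symm_op R" "\<And>x. inner (P x) x = inner (R x) x"
  shows "P = R"
proof (rule blinfun_eqI)
  fix x
  have "inner (P x) y = inner (R x) y" for y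
    using assms(3)[of "x + y"] assms(3)[of x] assms(3)[of y]
      symm_opD'[OF assms(1), of y x] symm_opD'[OF assms(2), of y x]
    by (simp add: blinfun.add_right inner_add_left inner_add_right)
  then show "P x = R x" by (metis vector_eq_rdot)
qed

lemma nonneg_form_cauchy_schwarz:
  assumes R: "symm_op R" "\<And>x. 0 \<le> inner (R x) x"
  shows "(inner (R x) y)\<^sup>2 \<le> inner (R x) x * inner (R y) y"
proof -
  have *: "0 \<le> inner (R x) x + 2 * t * inner (R x) y + t\<^sup>2 * inner (R y) y" for t
    using R(2)[of "x + t *\<^sub>R y"] symm_opD'[OF R(1), of y x]
    by (simp add: blinfun.add_right blinfun.scaleR_right inner_add_left inner_add_right
        power2_eq_square algebra_simps)
  show ?thesis
  proof (cases "inner (R y) y = 0")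
    case True
    \<comment> \<open>With the quadratic coefficient zero, the expression in \<open>*\<close> is
      affine in \<open>t\<close>; the chosen \<open>t\<close> would give it the value -1.\<close>
    have "inner (R x) y = 0"
    proof (rule ccontr)
      assume "inner (R x) y \<noteq> 0"
      then show False
        using *[of "- (inner (R x) x + 1) / (2 * inner (R x) y)"] True by (simp add: field_simps)
    qed
    with True show ?thesis by simp
  next
    case False
    then have "inner (R y) y > 0" using R(2)[of y] by simp
    then show ?thesis
      using *[of "- inner (R x) y / inner (R y) y"] by (simp add: field_simps power2_eq_square)
  qed
qed

lemma nonneg_form_eq_zero:
  assumes R: "symm_op R" "\<And>x. 0 \<le> inner (R x) x" and "inner (R x) x = 0"
  shows "R x = 0"
  using nonneg_form_cauchy_schwarz[OF R, of x "R x"] assms(3) by simp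


section \<open>Square roots\<close>

instance chilbert_space \<subseteq> banach ..

text \<open>Cauchy-Schwarz for the form of \<open>R\<close>, taken at \<open>x\<close> and
  \<open>R x\<close>, lets a bound on the form control the norm. The square root iteration needs the
  norm bound, whereas nonnegativity supplies only the form bound.\<close>

lemma norm_symm_op_le_1:
  assumes R: "symm_op R" "\<And>x. 0 \<le> inner (R x) x" "\<And>x. inner (R x) x \<le> inner x x"
  shows "norm R \<le> 1"
proof (rule norm_blinfun_bound)
  fix x
  have "(inner (R x) (R x))\<^sup>2 \<le> inner (R x) x * inner (R (R x)) (R x)"
    by (rule nonneg_form_cauchy_schwarz[OF R(1,2)])
  also have "\<dots> \<le> inner x x * inner (R x) (R x)"
    by (intro mult_mono R inner_ge_zero)
  finally have "inner (R x) (R x) * inner (R x) (R x) \<le> inner x x * inner (R x) (R x)"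
    by (simp add: power2_eq_square)
  then have "inner (R x) (R x) \<le> inner x x"
    by (cases "R x = 0") (auto simp: mult_le_cancel_right)
  then show "norm (R x) \<le> 1 * norm x"
    by (simp add: norm_le_square power2_norm_eq_inner norm_le)
qed simp

text \<open>
  With \<open>E = I - R\<close>, the iteration \<open>Y \<mapsto> (E + Y\<^sup>2) / 2\<close> has \<open>I - R\<^sup>1\<^sup>/\<^sup>2\<close> as its limit. It is dominated
  by the scalar iteration with \<open>E\<close> replaced by \<open>1\<close>, hence converges in norm.
\<close>

fun sqrt_iter :: "('a::real_normed_vector \<Rightarrow>\<^sub>L 'a) \<Rightarrow> nat \<Rightarrow> 'a \<Rightarrow>\<^sub>L 'a"
  where
    "sqrt_iter E 0 = 0"
  | "sqrt_iter E (Suc n) = (1/2) *\<^sub>R (E + sqrt_iter E n \<cdot> sqrt_iter E n)"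

fun sqrt_iter_bound :: "nat \<Rightarrow> real"
  where
    "sqrt_iter_bound 0 = 0"
  | "sqrt_iter_bound (Suc n) = (1 + (sqrt_iter_bound n)\<^sup>2) / 2"

lemma sqrt_iter_bound_le: "0 \<le> sqrt_iter_bound n \<and> sqrt_iter_bound n \<le> 1"
  by (induction n) (auto simp: power_le_one)

lemma sqrt_iter_bound_mono: "sqrt_iter_bound n \<le> sqrt_iter_bound (Suc n)"
  by (induction n) (auto intro!: power_mono simp: sqrt_iter_bound_le)

lemma norm_sqrt_iter_le:
  assumes "norm E \<le> 1"
  shows "norm (sqrt_iter E n) \<le> sqrt_iter_bound n"
proof (induction n)
  case (Suc n)
  have "norm (sqrt_iter E n \<cdot> sqrt_iter E n) \<le> norm (sqrt_iter E n) * norm (sqrt_iter E n)"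
    by (rule norm_blinfun_compose)
  also have "\<dots> \<le> (sqrt_iter_bound n)\<^sup>2"
    using Suc sqrt_iter_bound_le[of n] by (auto simp: power2_eq_square intro: mult_mono)
  finally show ?case
    using assms norm_triangle_ineq[of E "sqrt_iter E n \<cdot> sqrt_iter E n"] by simp
qed simp

lemma blinfun_compose_simps:
  fixes U U' :: "'b::real_normed_vector \<Rightarrow>\<^sub>L 'c::real_normed_vector"
    and V V' :: "'a::real_normed_vector \<Rightarrow>\<^sub>L 'b"
  shows "(U + U') \<cdot> V = U \<cdot> V + U' \<cdot> V" "(U - U') \<cdot> V = U \<cdot> V - U' \<cdot> V"
    "U \<cdot> (V + V') = U \<cdot> V + U \<cdot> V'" "U \<cdot> (V - V') = U \<cdot> V - U \<cdot> V'"
    "(r *\<^sub>R U) \<cdot> V = r *\<^sub>R (U \<cdot> V)" "U \<cdot> (r *\<^sub>R V) = r *\<^sub>R (U \<cdot> V)"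
    "U \<cdot> id_blinfun = U" "id_blinfun \<cdot> V = V"
  by (auto intro!: blinfun_eqI simp: blinfun.bilinear_simps)

lemma blinfun_compose_assoc: "U \<cdot> V \<cdot> W = U \<cdot> (V \<cdot> W)"
  by (rule blinfun_eqI) simp

text \<open>The splitting Z Z - Y Y = Z (Z - Y) + (Z - Y) Y holds without commutativity, and
  estimating each factor by its scalar counterpart reassembles exactly z^2 - y^2.\<close>

lemma norm_sqrt_iter_diff_le:
  assumes "norm E \<le> 1"
  shows "norm (sqrt_iter E (Suc n) - sqrt_iter E n) \<le> sqrt_iter_bound (Suc n) - sqrt_iter_bound n"
proof (induction n)
  case (Suc n)
  define Y Z where "Y = sqrt_iter E n" and "Z = sqrt_iter E (Suc n)"
  define y z where "y = sqrt_iter_bound n" and "z = sqrt_iter_bound (Suc n)"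
  have le: "norm Y \<le> y" "norm Z \<le> z" "norm (Z - Y) \<le> z - y"
    using Suc norm_sqrt_iter_le[OF assms] unfolding Y_def Z_def y_def z_def by blast+
  have "sqrt_iter E (Suc (Suc n)) - Z = (1/2) *\<^sub>R (Z \<cdot> (Z - Y) + (Z - Y) \<cdot> Y)"
    by (simp add: Y_def Z_def blinfun_compose_simps scaleR_diff_right scaleR_add_right)
  also have "norm \<dots> \<le> (1/2) * (norm (Z \<cdot> (Z - Y)) + norm ((Z - Y) \<cdot> Y))"
    using norm_triangle_ineq[of "Z \<cdot> (Z - Y)" "(Z - Y) \<cdot> Y"] by simp
  also have "\<dots> \<le> (1/2) * (norm Z * norm (Z - Y) + norm (Z - Y) * norm Y)"
    by (intro mult_left_mono add_mono norm_blinfun_compose) simp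
  also have "\<dots> \<le> (1/2) * (z * (z - y) + (z - y) * y)"
    using le order_trans[OF norm_ge_zero le(2)] order_trans[OF norm_ge_zero le(3)]
    by (intro mult_left_mono add_mono mult_mono) auto
  also have "\<dots> = sqrt_iter_bound (Suc (Suc n)) - z"
    by (simp add: y_def z_def power2_eq_square algebra_simps)
  finally show ?case by (simp add: Z_def z_def)
qed (use assms in simp)

lemma norm_sqrt_iter_dist_le:
  assumes "norm E \<le> 1" "m \<le> n"
  shows "norm (sqrt_iter E n - sqrt_iter E m) \<le> sqrt_iter_bound n - sqrt_iter_bound m"
  using assms(2)
proof (induction n rule: dec_induct)
  case (step n)
  have "norm (sqrt_iter E (Suc n) - sqrt_iter E m)
      \<le> norm (sqrt_iter E (Suc n) - sqrt_iter E n) + norm (sqrt_iter E n - sqrt_iter E m)"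
    using norm_triangle_ineq[of "sqrt_iter E (Suc n) - sqrt_iter E n" "sqrt_iter E n - sqrt_iter E m"]
    by simp
  then show ?case
    using step norm_sqrt_iter_diff_le[OF assms(1), of n] by linarith
qed simp

lemma sqrt_iter_convergent:
  fixes E :: "'a::banach \<Rightarrow>\<^sub>L 'a"
  assumes "norm E \<le> 1"
  shows "\<exists>Y. sqrt_iter E \<longlonglongrightarrow> Y"
proof -
  have "incseq sqrt_iter_bound"
    using sqrt_iter_bound_mono by (rule incseq_SucI)
  moreover have "Bseq sqrt_iter_bound"
    using sqrt_iter_bound_le by (intro BseqI[of 1]) auto
  ultimately have "convergent sqrt_iter_bound"
    by (intro Bseq_mono_convergent) (auto simp: incseq_def)
  then have C: "Cauchy sqrt_iter_bound" by (rule convergent_Cauchy)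
  have "Cauchy (sqrt_iter E)"
  proof (rule CauchyI)
    fix e :: real assume "0 < e"
    with C obtain M where M: "\<And>m n. m \<ge> M \<Longrightarrow> n \<ge> M \<Longrightarrow> norm (sqrt_iter_bound m - sqrt_iter_bound n) < e"
      by (meson CauchyD)
    have *: "norm (sqrt_iter E n - sqrt_iter E m) < e" if "m \<ge> M" "m \<le> n" for m n
      using norm_sqrt_iter_dist_le[OF assms that(2)] M[of n m] that by auto
    have "norm (sqrt_iter E m - sqrt_iter E n) < e" if "m \<ge> M" "n \<ge> M" for m n
      using *[of m n] *[of n m] that by (cases "m \<le> n") (auto simp: norm_minus_commute)
    then show "\<exists>M. \<forall>m\<ge>M. \<forall>n\<ge>M. norm (sqrt_iter E m - sqrt_iter E n) < e" by blast
  qed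
  from Cauchy_convergent[OF this] show ?thesis
    by (simp only: convergent_def)
qed

text \<open>The root is a norm limit of polynomials in \<open>R\<close>, hence the clause on
  \<open>V\<close>. That clause carries both the uniqueness of roots and the intertwining of defect
  operators.\<close>

lemma nonneg_sqrt_exists_contraction:
  fixes R :: "'a::chilbert_space \<Rightarrow>\<^sub>L 'a"
  assumes R: "nonneg_op R" "norm R \<le> 1"
  shows "\<exists>Z. nonneg_op Z \<and> Z \<cdot> Z = R \<and> (\<forall>V. V \<cdot> R = R \<cdot> V \<longrightarrow> V \<cdot> Z = Z \<cdot> V)"
proof -
  note R' = nonneg_opD[OF R(1)]
  define E where "E = id_blinfun - R"
  have "inner (R x) x \<le> inner x x" for x
  proof -
    have "inner (R x) x \<le> norm (R x) * norm x" by (rule norm_cauchy_schwarz)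
    also have "\<dots> \<le> norm x * norm x"
      using norm_blinfun_le[OF R(2), of x] by (simp add: mult_right_mono)
    finally show ?thesis by (simp add: norm_eq_square dot_square_norm power2_eq_square)
  qed
  then have E: "norm E \<le> 1"
    using R' unfolding E_def
    by (intro norm_symm_op_le_1 symm_op_intros)
      (auto simp: blinfun.bilinear_simps inner_simps)
  obtain Y where Y: "sqrt_iter E \<longlonglongrightarrow> Y" using sqrt_iter_convergent[OF E] by blast
  have lim: "(\<lambda>n. sqrt_iter E n x) \<longlonglongrightarrow> Y x" for x
    by (intro tendsto_intros Y)
  have iter_ops: "sqrt_iter E n \<in> ops UNIV UNIV" for n
    by (induction n) (auto simp: E_def R' intro!: ops_UNIV_intros)
  have "Y \<in> ops UNIV UNIV"
    unfolding ops_UNIV_iff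
  proof (intro allI)
    fix c x
    have "(\<lambda>n. c *\<^sub>C sqrt_iter E n x) \<longlonglongrightarrow> c *\<^sub>C Y x"
      by (rule bounded_linear.tendsto[OF bounded_linear_scaleC lim])
    then have "(\<lambda>n. sqrt_iter E n (c *\<^sub>C x)) \<longlonglongrightarrow> c *\<^sub>C Y x"
      by (simp add: ops_scaleC[OF iter_ops])
    then show "Y (c *\<^sub>C x) = c *\<^sub>C Y x"
      using lim LIMSEQ_unique by blast
  qed
  have iter_symm: "symm_op (sqrt_iter E n)" for n
    by (induction n) (auto simp: E_def R' intro!: symm_op_intros)
  have "symm_op Y"
    unfolding symm_op_def
  proof (intro allI)
    fix x y
    have "(\<lambda>n. inner (sqrt_iter E n x) y) \<longlonglongrightarrow> inner (Y x) y"
      "(\<lambda>n. inner x (sqrt_iter E n y)) \<longlonglongrightarrow> inner x (Y y)"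
      by (intro tendsto_intros lim)+
    then show "inner (Y x) y = inner x (Y y)"
      using symm_opD[OF iter_symm] LIMSEQ_unique by fastforce
  qed
  have "norm Y \<le> 1"
  proof (rule Lim_norm_ubound[OF _ Y])
    show "\<forall>\<^sub>F n in sequentially. norm (sqrt_iter E n) \<le> 1"
      using norm_sqrt_iter_le[OF E] sqrt_iter_bound_le by (intro always_eventually) (meson order_trans)
  qed simp
  have "(\<lambda>n. sqrt_iter E (Suc n)) \<longlonglongrightarrow> (1/2) *\<^sub>R (E + Y \<cdot> Y)"
    unfolding sqrt_iter.simps
    by (intro tendsto_intros bounded_bilinear.tendsto[OF bounded_bilinear_blinfun_compose] Y)
  then have fix_eq: "Y = (1/2) *\<^sub>R (E + Y \<cdot> Y)"
    using LIMSEQ_unique[OF LIMSEQ_Suc[OF Y]] by blast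
  define Z where "Z = id_blinfun - Y"
  \<comment> \<open>The fixed point equation says that the square of I - Y is I - E, which is
    \<open>R\<close>.\<close>
  have "2 *\<^sub>R Y = E + Y \<cdot> Y" by (subst fix_eq) simp
  then have ZZ: "Z \<cdot> Z = R"
    by (simp add: Z_def E_def blinfun_compose_simps scaleR_2 algebra_simps)
  have "inner (Y x) x \<le> inner x x" for x
  proof -
    have "inner (Y x) x \<le> norm (Y x) * norm x" by (rule norm_cauchy_schwarz)
    also have "\<dots> \<le> norm x * norm x"
      using norm_blinfun_le[OF \<open>norm Y \<le> 1\<close>, of x] by (simp add: mult_right_mono)
    finally show ?thesis by (simp add: dot_square_norm power2_eq_square)
  qed
  then have "nonneg_op Z"
    using \<open>Y \<in> ops UNIV UNIV\<close> \<open>symm_op Y\<close>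
    by (auto simp: nonneg_op_iff Z_def blinfun.bilinear_simps inner_simps
        intro!: ops_UNIV_intros symm_op_intros)
  moreover have "V \<cdot> Z = Z \<cdot> V" if V: "V \<cdot> R = R \<cdot> V" for V
  proof -
    have "V \<cdot> sqrt_iter E n = sqrt_iter E n \<cdot> V" for n
    proof (induction n)
      case (Suc n)
      then have "V \<cdot> (sqrt_iter E n \<cdot> sqrt_iter E n) = sqrt_iter E n \<cdot> sqrt_iter E n \<cdot> V"
        by (metis blinfun_compose_assoc)
      then show ?case
        using V by (simp add: E_def blinfun_compose_simps)
    qed (auto intro: blinfun_eqI)
    moreover have "(\<lambda>n. V \<cdot> sqrt_iter E n) \<longlonglongrightarrow> V \<cdot> Y" "(\<lambda>n. sqrt_iter E n \<cdot> V) \<longlonglongrightarrow> Y \<cdot> V"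
      by (intro bounded_bilinear.tendsto[OF bounded_bilinear_blinfun_compose] Y tendsto_const)+
    ultimately have "V \<cdot> Y = Y \<cdot> V"
      using LIMSEQ_unique by auto
    then show ?thesis by (simp add: Z_def blinfun_compose_simps)
  qed
  ultimately show ?thesis using ZZ by blast
qed

lemma nonneg_op_scaleR: "nonneg_op R \<Longrightarrow> 0 \<le> r \<Longrightarrow> nonneg_op (r *\<^sub>R R)"
  by (auto simp: nonneg_op_iff blinfun.bilinear_simps intro!: ops_UNIV_intros symm_op_intros)

lemma nonneg_sqrt_exists:
  fixes R :: "'a::chilbert_space \<Rightarrow>\<^sub>L 'a"
  assumes R: "nonneg_op R"
  shows "\<exists>Z. nonneg_op Z \<and> Z \<cdot> Z = R \<and> (\<forall>V. V \<cdot> R = R \<cdot> V \<longrightarrow> V \<cdot> Z = Z \<cdot> V)"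
proof -
  \<comment> \<open>The summand 1 keeps \<open>r\<close> positive when \<open>R = 0\<close>.\<close>
  define r where "r = norm R + 1"
  have r: "r > 0" "norm R \<le> r" by (auto simp: r_def add_nonneg_pos)
  have "nonneg_op ((1 / r) *\<^sub>R R)" "norm ((1 / r) *\<^sub>R R) \<le> 1"
    using r R by (auto intro: nonneg_op_scaleR)
  from nonneg_sqrt_exists_contraction[OF this] obtain Z where Z: "nonneg_op Z"
    "Z \<cdot> Z = (1 / r) *\<^sub>R R" "\<And>V. V \<cdot> ((1 / r) *\<^sub>R R) = ((1 / r) *\<^sub>R R) \<cdot> V \<Longrightarrow> V \<cdot> Z = Z \<cdot> V"
    by blast
  have "(sqrt r *\<^sub>R Z) \<cdot> (sqrt r *\<^sub>R Z) = R"
    using r Z(2) by (simp add: blinfun_compose_simps)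
  moreover have "V \<cdot> (sqrt r *\<^sub>R Z) = (sqrt r *\<^sub>R Z) \<cdot> V" if "V \<cdot> R = R \<cdot> V" for V
    using Z(3)[of V] that by (simp add: blinfun_compose_simps)
  moreover have "nonneg_op (sqrt r *\<^sub>R Z)"
    using nonneg_op_scaleR[OF Z(1)] r by simp
  ultimately show ?thesis by blast
qed

text \<open>For y = (Z - Z') x commutativity gives (Z + Z') y = 0. Two nonnegative forms with sum
  zero both vanish at y, so Z y = Z' y = 0, and moving Z - Z' across the inner product gives norm
  zero for y.\<close>

lemma nonneg_sqrt_unique:
  fixes Z Z' :: "'a::chilbert_space \<Rightarrow>\<^sub>L 'a"
  assumes Z: "nonneg_op Z" and Z': "nonneg_op Z'" and eq: "Z \<cdot> Z = Z' \<cdot> Z'"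
    and comm: "Z \<cdot> Z' = Z' \<cdot> Z"
  shows "Z = Z'"
proof (rule blinfun_eqI)
  fix x
  define y where "y = Z x - Z' x"
  have "Z (Z v) = Z' (Z' v)" "Z (Z' v) = Z' (Z v)" for v
    using arg_cong[OF eq, of "\<lambda>T. T v"] arg_cong[OF comm, of "\<lambda>T. T v"] by auto
  then have "Z y + Z' y = 0"
    by (simp add: y_def blinfun.bilinear_simps)
  then have "inner (Z y) y + inner (Z' y) y = 0"
    by (metis inner_add_left inner_zero_left)
  then have "inner (Z y) y = 0" "inner (Z' y) y = 0"
    using nonneg_opD(3)[OF Z, of y] nonneg_opD(3)[OF Z', of y] by linarith+
  then have "Z y = 0" "Z' y = 0"
    using nonneg_form_eq_zero nonneg_opD[OF Z] nonneg_opD[OF Z'] by blast+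
  then have "inner (Z x - Z' x) y = 0"
    using symm_opD[OF nonneg_opD(2)[OF Z], of x y] symm_opD[OF nonneg_opD(2)[OF Z'], of x y]
    by (simp add: inner_diff_left)
  then show "Z x = Z' x" by (simp add: y_def)
qed

lemma nonneg_op_square:
  assumes "nonneg_op Z"
  shows "nonneg_op (Z \<cdot> Z)"
proof -
  note Z = nonneg_opD[OF assms]
  have "0 \<le> inner (Z (Z x)) x" for x
    using symm_opD[OF Z(2), of "Z x" x] by simp
  then show ?thesis
    using Z(1,2) unfolding nonneg_op_iff by (auto intro!: ops_UNIV_intros symm_op_intros)
qed

text \<open>Every root of \<open>R\<close> commutes with \<open>R\<close>, hence with the
  constructed root \<open>Z0\<close>. Uniqueness among commuting roots is therefore enough.\<close>

lemma op_sqrt_equality: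
  assumes Z: "nonneg_op Z" "Z \<cdot> Z = R"
  shows "op_sqrt R = Z"
proof -
  have "nonneg_op R"
    using nonneg_op_square[OF Z(1)] Z(2) by simp
  then obtain Z0 where Z0: "nonneg_op Z0" "Z0 \<cdot> Z0 = R" "\<And>V. V \<cdot> R = R \<cdot> V \<Longrightarrow> V \<cdot> Z0 = Z0 \<cdot> V"
    using nonneg_sqrt_exists by blast
  have *: "Z' = Z0" if "nonneg_op Z'" "Z' \<cdot> Z' = R" for Z'
  proof (rule nonneg_sqrt_unique)
    show "Z' \<cdot> Z0 = Z0 \<cdot> Z'"
      by (rule Z0(3)) (simp add: blinfun_compose_assoc flip: that(2))
  qed (use that Z0(1,2) in simp_all)
  show ?thesis
    unfolding op_sqrt_def
  proof (rule the_equality)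
    show "Z' = Z" if "nonneg_op Z' \<and> Z' \<cdot> Z' = R" for Z'
      using that *[of Z'] *[OF Z] by simp
  qed (use Z in simp)
qed

lemma op_sqrt:
  assumes "nonneg_op R"
  shows nonneg_op_sqrt: "nonneg_op (op_sqrt R)"
    and op_sqrt_square: "op_sqrt R \<cdot> op_sqrt R = R"
    and op_sqrt_commute: "V \<cdot> R = R \<cdot> V \<Longrightarrow> V \<cdot> op_sqrt R = op_sqrt R \<cdot> V"
proof -
  obtain Z where Z: "nonneg_op Z" "Z \<cdot> Z = R" "\<And>V. V \<cdot> R = R \<cdot> V \<Longrightarrow> V \<cdot> Z = Z \<cdot> V"
    using nonneg_sqrt_exists[OF assms] by blast
  have eq: "op_sqrt R = Z" by (rule op_sqrt_equality) fact+
  show "nonneg_op (op_sqrt R)" "op_sqrt R \<cdot> op_sqrt R = R"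
    unfolding eq by fact+
  show "V \<cdot> op_sqrt R = op_sqrt R \<cdot> V" if "V \<cdot> R = R \<cdot> V"
    unfolding eq using that by (rule Z(3))
qed

lemma op_sqrt_apply_twice: "nonneg_op R \<Longrightarrow> op_sqrt R (op_sqrt R x) = R x"
  using op_sqrt_square by (metis blinfun_apply_blinfun_compose)

lemma norm_op_sqrt:
  assumes "nonneg_op R"
  shows "(norm (op_sqrt R x))\<^sup>2 = inner (R x) x"
  using symm_opD[OF nonneg_opD(2)[OF nonneg_op_sqrt[OF assms]], of "op_sqrt R x" x]
  by (simp add: power2_norm_eq_inner op_sqrt_apply_twice[OF assms])


section \<open>Closed subspaces and quotients by square roots\<close>

definition closed_csubspace :: "'a::chilbert_space set \<Rightarrow> bool"
  where "closed_csubspace K \<longleftrightarrow> closed K \<and> subspace K \<and> (\<forall>c. \<forall>y\<in>K. c *\<^sub>C y \<in> K)"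

lemma closure_range_mapping:
  fixes f :: "'b::topological_space \<Rightarrow> 'c::topological_space"
  assumes "x \<in> closure (range g)" "continuous_on UNIV f" "\<And>u. f (g u) \<in> K" "closed K"
  shows "f x \<in> K"
proof -
  have "closed (f -` K)"
    using assms(4,2) by (rule closed_vimage)
  then have "closure (range g) \<subseteq> f -` K"
    using assms(3) by (intro closure_minimal) auto
  with assms(1) show ?thesis by blast
qed

lemma closed_csubspace_closure_range:
  assumes "R \<in> ops UNIV UNIV"
  shows "closed_csubspace (closure (range (blinfun_apply R)))"
  unfolding closed_csubspace_def
proof (intro conjI allI ballI)
  show "subspace (closure (range (blinfun_apply R)))"
    by (intro subspace_closure linear_subspace_image subspace_UNIV
        bounded_linear.linear[OF blinfun.bounded_linear_right])
  show "c *\<^sub>C y \<in> closure (range (blinfun_apply R))" if "y \<in> closure (range (blinfun_apply R))" for c y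
  proof (rule closure_range_mapping[OF that, of "\<lambda>y. c *\<^sub>C y"])
    show "continuous_on UNIV (\<lambda>y. c *\<^sub>C (y :: 'b))"
      by (rule bounded_linear.continuous_on[OF bounded_linear_scaleC continuous_on_id])
    show "c *\<^sub>C R u \<in> closure (range (blinfun_apply R))" for u
      using closure_subset[of "range (blinfun_apply R)"] by (auto simp: ops_scaleC[OF assms, symmetric])
  qed simp
qed simp

context
  fixes K :: "'a::chilbert_space set"
  assumes K: "closed_csubspace K"
begin

lemma in_ortho_csubspace: "x \<in> ortho K \<longleftrightarrow> (\<forall>y\<in>K. inner x y = 0)"
  using K by (intro in_ortho_iff_inner) (simp add: closed_csubspace_def)

lemma ortho_decomposition_unique:
  assumes "p \<in> K" "x - p \<in> ortho K" "p' \<in> K" "x - p' \<in> ortho K"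
  shows "p = p'"
proof -
  have "p - p' \<in> K"
    using assms K by (simp add: closed_csubspace_def subspace_diff)
  then have "inner (x - p) (p - p') = 0" "inner (x - p') (p - p') = 0"
    using assms(2,4) by (auto simp: in_ortho_csubspace)
  then have "inner (p - p') (p - p') = 0"
    by (simp add: inner_diff_left)
  then show ?thesis by simp
qed

lemma proj_eqI:
  fixes P :: "'a \<Rightarrow>\<^sub>L 'a"
  assumes "\<And>x. P x \<in> K" "\<And>x. x - P x \<in> ortho K"
  shows "proj K = P"
  unfolding proj_def
proof (rule the_equality)
  show "P' = P" if "\<forall>x. P' x \<in> K \<and> x - P' x \<in> ortho K" for P' :: "'a \<Rightarrow>\<^sub>L 'a"
    using that assms by (intro blinfun_eqI ortho_decomposition_unique) auto
qed (use assms in simp)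

lemma proj_in: "proj K x \<in> K"
  and minus_proj_in_ortho: "x - proj K x \<in> ortho K"
proof -
  have sub: "subspace K" and cl: "closed K" using K by (auto simp: closed_csubspace_def)
  have "\<exists>p. p \<in> K \<and> x - p \<in> ortho K" for x
    using orthogonal_decomposition_exists[OF cl sub, of x] by (auto simp: in_ortho_csubspace)
  then obtain g where g: "\<And>x. g x \<in> K" "\<And>x. x - g x \<in> ortho K" by metis
  have "bounded_linear g"
  proof (rule bounded_linear_intro[where K = 1])
    show "g (x + y) = g x + g y" for x y
    proof (rule ortho_decomposition_unique)
      show "x + y - (g x + g y) \<in> ortho K"
        using g(2)[of x] g(2)[of y] by (simp add: in_ortho_csubspace inner_diff_left inner_add_left)
    qed (use g sub in \<open>auto simp: subspace_add\<close>)
    show "g (r *\<^sub>R x) = r *\<^sub>R g x" for r x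
    proof (rule ortho_decomposition_unique)
      show "r *\<^sub>R x - r *\<^sub>R g x \<in> ortho K"
        using g(2)[of x] by (simp add: in_ortho_csubspace flip: scaleR_diff_right)
    qed (use g sub in \<open>auto simp: subspace_scale\<close>)
    fix x
    have "inner (x - g x) (g x) = 0"
      using g[of x] by (simp add: in_ortho_csubspace)
    then have "(norm (g x))\<^sup>2 = inner x (g x)"
      by (simp add: power2_norm_eq_inner inner_diff_left)
    also have "\<dots> \<le> norm x * norm (g x)" by (rule norm_cauchy_schwarz)
    finally show "norm (g x) \<le> norm x * 1"
      by (cases "g x = 0") (auto simp: power2_eq_square)
  qed
  then have "proj K = Blinfun g"
    using g by (intro proj_eqI) (simp_all add: bounded_linear_Blinfun_apply)
  with \<open>bounded_linear g\<close> g show "proj K x \<in> K" "x - proj K x \<in> ortho K"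
    by (simp_all add: bounded_linear_Blinfun_apply)
qed

lemma proj_eq_self: "x \<in> K \<Longrightarrow> proj K x = x"
  by (rule ortho_decomposition_unique[OF proj_in minus_proj_in_ortho])
    (simp_all add: in_ortho_csubspace)

lemma ops_proj: "proj K \<in> ops UNIV UNIV"
  unfolding ops_UNIV_iff
proof (intro allI)
  fix c x
  have "c *\<^sub>C x - c *\<^sub>C proj K x \<in> ortho K"
    using minus_proj_in_ortho[of x]
    by (simp add: ortho_def cinner_scaleC_left flip: scaleC_diff_right)
  then show "proj K (c *\<^sub>C x) = c *\<^sub>C proj K x"
    using K proj_in minus_proj_in_ortho
    by (intro ortho_decomposition_unique[of _ "c *\<^sub>C x"]) (auto simp: closed_csubspace_def)
qed

lemma inner_proj: "inner (proj K x) y = inner (proj K x) (proj K y)"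
proof -
  have "inner (y - proj K y) (proj K x) = 0"
    using minus_proj_in_ortho[of y] proj_in[of x] by (simp add: in_ortho_csubspace)
  then show ?thesis by (simp add: inner_diff_right inner_commute[of _ "proj K x"])
qed

lemma symm_op_proj: "symm_op (proj K)"
  unfolding symm_op_def by (metis inner_proj inner_commute)

lemma ops_apply_proj: "T \<in> ops K K' \<Longrightarrow> T (proj K x) = T x"
proof -
  assume "T \<in> ops K K'"
  then have "T (x - proj K x) = 0"
    using minus_proj_in_ortho[of x] by (simp add: ops_def)
  then show ?thesis by (simp add: blinfun.diff_right)
qed

end

lemma closed_csubspace_UNIV: "closed_csubspace UNIV"
  by (simp add: closed_csubspace_def)

lemma proj_UNIV: "proj UNIV = id_blinfun"
  by (rule proj_eqI[OF closed_csubspace_UNIV]) (simp_all add: ortho_UNIV)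

lemma closed_csubspace_Times_UNIV:
  assumes "closed_csubspace K"
  shows "closed_csubspace (UNIV \<times> K)"
  using assms unfolding closed_csubspace_def
  by (auto simp: closed_Times scaleC_prod_def subspace_def zero_prod_def)

lemma proj_UNIV_Times:
  assumes K: "closed_csubspace K"
  shows "proj (UNIV \<times> K) = block id_blinfun 0 0 (proj K)"
proof (rule proj_eqI[OF closed_csubspace_Times_UNIV[OF K]])
  fix z :: "'b \<times> 'a"
  show "block id_blinfun 0 0 (proj K) z \<in> UNIV \<times> K"
    using proj_in[OF K] by (simp add: block.rep_eq)
  show "z - block id_blinfun 0 0 (proj K) z \<in> ortho (UNIV \<times> K)"
    using minus_proj_in_ortho[OF K, of "snd z"]
    by (auto simp: in_ortho_csubspace[OF closed_csubspace_Times_UNIV[OF K]] in_ortho_csubspace[OF K]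
        block.rep_eq inner_prod_def)
qed

section \<open>Moore-Penrose inverses of square roots\<close>

lemma mp_inv_eqI:
  assumes H: "H \<in> ops UNIV UNIV" "symm_op H" and k: "k \<in> closure (range (blinfun_apply H))"
  shows "mp_inv H (H k) = k"
  unfolding mp_inv_def
proof (rule the_equality)
  have ker: "x \<in> ortho {z. H z = 0} \<longleftrightarrow> (\<forall>z. H z = 0 \<longrightarrow> inner x z = 0)" for x
    by (subst in_ortho_iff_inner) (auto simp: ops_scaleC[OF H(1)] scaleC_zero_right)
  have ran: "x \<in> ortho (range (blinfun_apply H)) \<longleftrightarrow> (\<forall>z. inner x (H z) = 0)" for x
    by (subst in_ortho_iff_inner) (auto simp: ops_scaleC[OF H(1), symmetric])
  \<comment> \<open>Symmetry makes the range of \<open>H\<close> orthogonal to its kernel, and this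
    persists on the closure. So \<open>k\<close> is the preimage of \<open>H k\<close> without
    kernel component, the one that the Moore-Penrose inverse selects.\<close>
  have k_ker: "inner k z = 0" if "H z = 0" for z
  proof -
    have "k \<in> {w. inner w z = 0}"
      using k by (rule closure_range_mapping[of _ _ "\<lambda>w. w"])
        (auto simp: symm_opD[OF H(2)] that intro!: closed_Collect_eq continuous_intros)
    then show ?thesis by simp
  qed
  then show "k \<in> ortho {z. H z = 0} \<and> H k - H k \<in> ortho (range (blinfun_apply H))"
    by (simp add: ker ran)
  fix x assume x: "x \<in> ortho {z. H z = 0} \<and> H k - H x \<in> ortho (range (blinfun_apply H))"
  then have "inner (H k - H x) (H (k - x)) = 0"
    unfolding ran by blast
  then have "H (k - x) = 0"
    by (simp add: blinfun.diff_right)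
  then have "inner k (k - x) = 0" "inner x (k - x) = 0"
    using k_ker[of "k - x"] x by (auto simp: ker)
  then have "inner (k - x) (k - x) = 0" by (simp add: inner_diff_left)
  then show "x = k" by simp
qed

context
  fixes R :: "'b::chilbert_space \<Rightarrow>\<^sub>L 'b" and Y :: "'a::chilbert_space \<Rightarrow>\<^sub>L 'b" and c :: real
  assumes R: "nonneg_op R" and Y: "Y \<in> ops UNIV UNIV"
    and bound: "\<And>u. norm ((Y\<^sup>\<dagger>) u) \<le> c * norm (op_sqrt R u)"
    and c: "0 \<le> c"
begin

text \<open>\<open>bound\<close> is Douglas' quantitative form of the inclusion of ran Y in ran
  R^{1/2}: it lets the functional of \<open>Y x\<close> factor through \<open>op_sqrt R\<close>. The
  representing vector is unique in the closure of the range, and this uniqueness yields its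
  linearity in \<open>x\<close>.\<close>

lemma inv_sqrt_comp:
  shows ops_inv_sqrt_comp: "inv_sqrt_comp R Y \<in> ops UNIV UNIV"
    and op_sqrt_inv_sqrt_comp: "op_sqrt R (inv_sqrt_comp R Y x) = Y x"
    and inv_sqrt_comp_in_closure: "inv_sqrt_comp R Y x \<in> closure (range (op_sqrt R))"
proof -
  define H where "H = op_sqrt R"
  have H: "H \<in> ops UNIV UNIV" "symm_op H"
    using nonneg_opD[OF nonneg_op_sqrt[OF R]] by (auto simp: H_def)
  have lin: "linear (blinfun_apply H)"
    by (rule bounded_linear.linear[OF blinfun.bounded_linear_right])
  have "\<exists>k\<in>closure (range (blinfun_apply H)). H k = Y x" for x
  proof -
    have "\<bar>inner (Y x) u\<bar> \<le> (norm x * c) * norm (H u)" for u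
    proof -
      have "\<bar>inner (Y x) u\<bar> \<le> norm x * norm ((Y\<^sup>\<dagger>) u)"
        using Cauchy_Schwarz_ineq2[of x "(Y\<^sup>\<dagger>) u"] by (simp add: inner_adj[OF Y])
      also have "\<dots> \<le> norm x * (c * norm (H u))"
        using bound by (intro mult_left_mono) (auto simp: H_def)
      finally show ?thesis by (simp add: mult.assoc)
    qed
    then obtain k where k: "k \<in> closure (range (blinfun_apply H))" "\<And>u. inner (Y x) u = inner k (H u)"
      using functional_factorization[OF lin, of "inner (Y x)"]
        bounded_linear.linear[OF bounded_linear_inner_right] by blast
    then have "inner (H k) u = inner (Y x) u" for u
      by (simp add: symm_opD[OF H(2)])
    then have "H k = Y x" by (metis vector_eq_rdot)
    with k(1) show ?thesis by blast
  qed
  then obtain g where g: "g x \<in> closure (range (blinfun_apply H))" "H (g x) = Y x" for x by metis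
  then have mp: "mp_inv H (Y x) = g x" for x
    using mp_inv_eqI[OF H] by metis
  have unique: "k = k'" if "k \<in> closure (range (blinfun_apply H))"
    "k' \<in> closure (range (blinfun_apply H))" "H k = H k'" for k k'
    using mp_inv_eqI[OF H] that by metis
  have sub: "subspace (closure (range (blinfun_apply H)))"
    and sub': "\<And>a y. y \<in> closure (range (blinfun_apply H)) \<Longrightarrow> a *\<^sub>C y \<in> closure (range (blinfun_apply H))"
    using closed_csubspace_closure_range[OF H(1)] by (auto simp: closed_csubspace_def)
  have "bounded_linear g"
  proof (rule bounded_linear_intro[where K = c])
    show "g (x + y) = g x + g y" for x y
      by (rule unique) (simp_all add: g sub subspace_add blinfun.add_right)
    show "g (r *\<^sub>R x) = r *\<^sub>R g x" for r x
      by (rule unique) (simp_all add: g sub subspace_scale blinfun.scaleR_right)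
    fix x
    \<comment> \<open>Once extended from the range of \<open>H\<close> to its closure, this estimate
      can be tested at \<open>g x\<close> itself, which bounds its norm.\<close>
    have "inner (g x) (H u) \<le> norm x * c * norm (H u)" for u
    proof -
      have "inner (g x) (H u) = inner x ((Y\<^sup>\<dagger>) u)"
        using symm_opD[OF H(2), of "g x" u] by (simp add: g inner_adj[OF Y])
      also have "\<dots> \<le> norm x * norm ((Y\<^sup>\<dagger>) u)" by (rule norm_cauchy_schwarz)
      also have "\<dots> \<le> norm x * (c * norm (H u))"
        using bound by (intro mult_left_mono) (auto simp: H_def)
      finally show ?thesis by (simp add: mult.assoc)
    qed
    then have "range (blinfun_apply H) \<subseteq> {w. inner (g x) w \<le> norm x * c * norm w}"
      by auto
    then have "closure (range (blinfun_apply H)) \<subseteq> {w. inner (g x) w \<le> norm x * c * norm w}"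
      by (rule closure_minimal) (intro closed_Collect_le continuous_intros)
    from subsetD[OF this g(1)[of x]] have *: "norm (g x) * norm (g x) \<le> norm (g x) * (norm x * c)"
      by (simp add: dot_square_norm power2_eq_square ac_simps)
    show "norm (g x) \<le> norm x * c"
      using * c by (cases "g x = 0") simp_all
  qed
  then have W: "inv_sqrt_comp R Y x = g x" for x
    unfolding inv_sqrt_comp_def H_def[symmetric] mp by (simp add: bounded_linear_Blinfun_apply)
  show "op_sqrt R (inv_sqrt_comp R Y x) = Y x" "inv_sqrt_comp R Y x \<in> closure (range (op_sqrt R))"
    using g unfolding W H_def by auto
  have "g (a *\<^sub>C x) = a *\<^sub>C g x" for a x
    by (rule unique) (simp_all add: g sub' ops_scaleC[OF Y] ops_scaleC[OF H(1)])
  then show "inv_sqrt_comp R Y \<in> ops UNIV UNIV"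
    by (simp add: ops_UNIV_iff W)
qed

text \<open>Completing the square: with k = R^{-1/2} Y x the expression on the right equals
  norm(k)^2 - norm(k - R^{1/2} u)^2, and \<open>k\<close> is a limit of vectors R^{1/2} u. The
  right-hand side is free of inverses.\<close>

lemma norm_inv_sqrt_comp_le_iff:
  "(norm (inv_sqrt_comp R Y x))\<^sup>2 \<le> r \<longleftrightarrow> (\<forall>u. 2 * inner (Y x) u - inner (R u) u \<le> r)"
proof -
  define k where "k = inv_sqrt_comp R Y x"
  note H = nonneg_opD[OF nonneg_op_sqrt[OF R]]
  have *: "2 * inner (Y x) u - inner (R u) u = 2 * inner k (op_sqrt R u) - (norm (op_sqrt R u))\<^sup>2" for u
    using symm_opD[OF H(2), of k u] by (simp add: k_def op_sqrt_inv_sqrt_comp norm_op_sqrt[OF R])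
  have "2 * inner k w - (norm w)\<^sup>2 \<le> (norm k)\<^sup>2" for w
    using zero_le_power2[of "norm (k - w)"]
    by (simp add: power2_norm_eq_inner inner_diff_left inner_diff_right inner_commute[of w k])
  then have "\<forall>u. 2 * inner (Y x) u - inner (R u) u \<le> r" if "(norm k)\<^sup>2 \<le> r"
    using that unfolding * by (meson order_trans)
  moreover have "(norm k)\<^sup>2 \<le> r" if "\<forall>u. 2 * inner (Y x) u - inner (R u) u \<le> r"
  proof -
    have "range (op_sqrt R) \<subseteq> {w. 2 * inner k w - (norm w)\<^sup>2 \<le> r}"
      using that unfolding * by auto
    then have "closure (range (op_sqrt R)) \<subseteq> {w. 2 * inner k w - (norm w)\<^sup>2 \<le> r}"
      by (rule closure_minimal) (intro closed_Collect_le continuous_intros)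
    from subsetD[OF this inv_sqrt_comp_in_closure[of x]] show ?thesis
      by (simp add: power2_norm_eq_inner k_def)
  qed
  ultimately show ?thesis unfolding k_def by blast
qed

lemma inner_inv_sandwich: "inner (inv_sandwich R Y x) x = (norm (inv_sqrt_comp R Y x))\<^sup>2"
  and ops_inv_sandwich: "inv_sandwich R Y \<in> ops UNIV UNIV"
  and symm_op_inv_sandwich: "symm_op (inv_sandwich R Y)"
  using ops_inv_sqrt_comp
  by (simp_all add: inv_sandwich_def inner_adj power2_norm_eq_inner ops_UNIV_compose ops_adj
      symm_op_sandwich)

end


section \<open>Schur complements, shorted operators and defect operators\<close>

context
  fixes P :: "'h::chilbert_space \<Rightarrow>\<^sub>L 'h" and Y :: "'h \<Rightarrow>\<^sub>L 'm::chilbert_space" and R :: "'m \<Rightarrow>\<^sub>L 'm"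
  assumes P: "P \<in> ops UNIV UNIV" "symm_op P"
    and Y: "Y \<in> ops UNIV UNIV"
    and R: "R \<in> ops UNIV UNIV" "symm_op R"
    and form_nonneg: "\<And>x u. 0 \<le> inner (P x) x - 2 * inner (Y x) u + inner (R u) u"
begin

lemma schur_corner_nonneg: "nonneg_op R"
  using form_nonneg[of 0] R by (simp add: nonneg_op_iff)

text \<open>The form is that of the block operator \<open>B\<close>. Cauchy-Schwarz at
  \<open>(y, 0)\<close> and \<open>(0, u)\<close> with \<open>y = (Y\<^sup>\<dagger>) u\<close>
  bounds norm(y)^4 by \<open>inner (P y) y\<close> times \<open>inner (R u) u\<close>; cancelling
  norm(y)^2 leaves the constant \<open>sqrt (norm P)\<close>.\<close>

lemma schur_bound: "norm ((Y\<^sup>\<dagger>) u) \<le> sqrt (norm P) * norm (op_sqrt R u)"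
proof -
  define B where "B = block P (- (Y\<^sup>\<dagger>)) (- Y) R"
  define y where "y = (Y\<^sup>\<dagger>) u"
  have "inner (B z) z = inner (P (fst z)) (fst z) - 2 * inner (Y (fst z)) (snd z) + inner (R (snd z)) (snd z)"
    for z
    by (simp add: B_def block.rep_eq inner_prod_def blinfun.minus_left inner_adj[OF Y] inner_diff_left
        inner_commute[of "snd z" "Y (fst z)"])
  then have "0 \<le> inner (B z) z" for z
    using form_nonneg by simp
  moreover have "symm_op B"
    by (simp add: symm_op_def B_def block.rep_eq inner_prod_def blinfun.minus_left inner_adj[OF Y]
        inner_diff_left inner_diff_right symm_opD[OF P(2)] symm_opD[OF R(2)])
  ultimately have "(inner (B (y, 0)) (0, u))\<^sup>2 \<le> inner (B (y, 0)) (y, 0) * inner (B (0, u)) (0, u)"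
    by (intro nonneg_form_cauchy_schwarz)
  then have "(inner (Y y) u)\<^sup>2 \<le> inner (P y) y * (norm (op_sqrt R u))\<^sup>2"
    by (simp add: B_def block.rep_eq blinfun.minus_left norm_op_sqrt[OF schur_corner_nonneg])
  moreover have "inner (P y) y \<le> norm P * (norm y)\<^sup>2"
    using norm_cauchy_schwarz[of "P y" y] mult_right_mono[OF norm_blinfun[of P y] norm_ge_zero[of y]]
    by (simp add: power2_eq_square)
  moreover have "inner (Y y) u = (norm y)\<^sup>2"
    by (simp add: y_def power2_norm_eq_inner inner_adj[OF Y])
  ultimately have "((norm y)\<^sup>2)\<^sup>2 \<le> norm P * (norm y)\<^sup>2 * (norm (op_sqrt R u))\<^sup>2"
    by (smt (verit) mult_right_mono zero_le_power2)
  then have "(norm y)\<^sup>2 * (norm y)\<^sup>2 \<le> (norm y)\<^sup>2 * (sqrt (norm P) * norm (op_sqrt R u))\<^sup>2"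
    by (simp add: power2_eq_square[of "(norm y)\<^sup>2"] power_mult_distrib ac_simps)
  then have "(norm y)\<^sup>2 \<le> (sqrt (norm P) * norm (op_sqrt R u))\<^sup>2 \<or> norm y = 0"
    using mult_left_le_imp_le[of "(norm y)\<^sup>2"] zero_less_power[of "norm y" 2]
    by (metis norm_ge_zero order_le_less)
  then show ?thesis
    unfolding y_def[symmetric] by (auto intro: power2_le_imp_le)
qed

lemmas schur_facts = schur_corner_nonneg Y schur_bound real_sqrt_ge_zero[OF norm_ge_zero]

lemma schur_ops: "P - inv_sandwich R Y \<in> ops UNIV UNIV"
  by (intro ops_UNIV_diff P ops_inv_sandwich[OF schur_facts])

lemma schur_symm: "symm_op (P - inv_sandwich R Y)"
  by (intro symm_op_intros P symm_op_inv_sandwich[OF schur_facts])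

text \<open>The Schur complement is the infimum of the form over \<open>u\<close>, phrased through
  lower bounds so that a nonattained infimum causes no trouble. Maximality of the short and the
  comparison of T with Q both rest on this equivalence.\<close>

lemma le_schur_form_iff:
  "r \<le> inner ((P - inv_sandwich R Y) x) x \<longleftrightarrow>
    (\<forall>u. r \<le> inner (P x) x - 2 * inner (Y x) u + inner (R u) u)"
proof -
  have "r \<le> inner ((P - inv_sandwich R Y) x) x \<longleftrightarrow> (norm (inv_sqrt_comp R Y x))\<^sup>2 \<le> inner (P x) x - r"
    by (simp add: blinfun.diff_left inner_diff_left inner_inv_sandwich[OF schur_facts])
      (auto simp: algebra_simps)
  also have "\<dots> \<longleftrightarrow> (\<forall>u. 2 * inner (Y x) u - inner (R u) u \<le> inner (P x) x - r)"
    by (rule norm_inv_sqrt_comp_le_iff[OF schur_facts])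
  finally show ?thesis by (simp add: algebra_simps)
qed

text \<open>A competitor \<open>Z\<close> with range in the first summand kills the second one by
  symmetry, so its form at \<open>(x, u)\<close> is independent of \<open>u\<close>. Being below
  \<open>K\<close>, it is then a lower bound of the form of \<open>K\<close> over all
  \<open>u\<close>, hence below the Schur complement.\<close>

lemma shorted_eq_schur:
  assumes K: "K \<in> ops UNIV UNIV" "symm_op K"
    and K_form: "\<And>x u. inner (K (x, u)) (x, u) = inner (P x) x - 2 * inner (Y x) u + inner (R u) u"
  shows "shorted K (UNIV \<times> {0}) = on_fst (P - inv_sandwich R Y)"
proof -
  define M where "M = P - inv_sandwich R Y"
  define \<Z> where "\<Z> = {Z. op_le 0 Z \<and> op_le Z K \<and> range (blinfun_apply Z) \<subseteq> UNIV \<times> {0}}"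
  have on_fst: "on_fst M (x, u) = (M x, 0)" for x and u :: 'm
    by (simp add: on_fst_def block.rep_eq)
  have M_ops: "on_fst M \<in> ops UNIV UNIV"
    by (auto simp: on_fst_def M_def intro!: ops_UNIV_intros schur_ops)
  have M_symm: "symm_op (on_fst M :: ('h \<times> 'm) \<Rightarrow>\<^sub>L ('h \<times> 'm))"
    by (auto simp: on_fst_def M_def intro!: symm_op_block schur_symm symm_op_intros)
  have M_le: "inner (M x) x \<le> inner (K (x, u)) (x, u)" for x u
    using le_schur_form_iff[of "inner (M x) x" x] by (simp add: M_def K_form)
  have "0 \<le> inner (M x) x" for x
    using form_nonneg by (simp add: M_def le_schur_form_iff)
  then have "op_le 0 (on_fst M :: ('h \<times> 'm) \<Rightarrow>\<^sub>L ('h \<times> 'm))"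
    using M_ops M_symm by (auto simp: op_le_def nonneg_op_iff on_fst inner_prod_def)
  moreover have "op_le (on_fst M) K"
    unfolding op_le_def nonneg_op_iff
  proof (intro conjI allI ops_UNIV_intros symm_op_intros K M_ops M_symm)
    fix z :: "'h \<times> 'm"
    show "0 \<le> inner ((K - on_fst M) z) z"
      using M_le[of "fst z" "snd z"] on_fst[of "fst z" "snd z"]
      by (simp add: blinfun.diff_left inner_diff_left) (simp add: inner_prod_def)
  qed
  ultimately have in_Z: "on_fst M \<in> \<Z>"
    by (auto simp: \<Z>_def on_fst)
  have max: "op_le Z (on_fst M)" if "Z \<in> \<Z>" for Z
    unfolding op_le_def nonneg_op_iff
  proof (intro conjI allI ops_UNIV_intros symm_op_intros K M_ops M_symm)
    have Z0: "op_le 0 Z" and ZK: "op_le Z K" and ran: "range (blinfun_apply Z) \<subseteq> UNIV \<times> {0}"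
      using that by (auto simp: \<Z>_def)
    show Z: "Z \<in> ops UNIV UNIV" "symm_op Z"
      using Z0 by (auto simp: op_le_def nonneg_op_iff)
    have snd: "snd (Z z) = 0" for z
      using ran by (metis mem_Times_iff rangeI singletonD subsetD)
    have "inner (Z (0, u)) w = 0" for u w
      using symm_opD[OF Z(2), of "(0, u)" w] snd[of w] by (simp add: inner_prod_def)
    then have "Z (0, u) = 0" for u by (metis inner_eq_zero_iff)
    then have eq: "Z (x, u) = Z (x, 0)" for x u
      using blinfun.add_right[of Z "(x, 0)" "(0, u)"] by simp
    fix z :: "'h \<times> 'm"
    obtain x u where z: "z = (x, u)" by fastforce
    have "inner (Z (x, 0)) (x, 0) \<le> inner (K (x, v)) (x, v)" for v
    proof -
      have "0 \<le> inner ((K - Z) (x, v)) (x, v)"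
        using ZK by (simp add: op_le_def nonneg_op_iff)
      then show ?thesis
        using snd[of "(x, 0)"] by (simp add: blinfun.diff_left inner_diff_left eq[of x v]) (simp add: inner_prod_def)
    qed
    then have "inner (Z (x, 0)) (x, 0) \<le> inner (M x) x"
      by (simp add: M_def le_schur_form_iff K_form)
    then show "0 \<le> inner ((on_fst M - Z) z) z"
      using snd[of "(x, 0)"]
      by (simp add: z blinfun.diff_left inner_diff_left on_fst eq[of x u]) (simp add: inner_prod_def)
  qed
  show ?thesis
    unfolding shorted_def Let_def \<Z>_def[symmetric] M_def[symmetric]
  proof (rule the_equality)
    show "on_fst M \<in> \<Z> \<and> (\<forall>Z'\<in>\<Z>. op_le Z' (on_fst M))"
      using in_Z max by blast
    fix Z assume Z: "Z \<in> \<Z> \<and> (\<forall>Z'\<in>\<Z>. op_le Z' Z)"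
    then have "op_le (on_fst M) Z" "op_le Z (on_fst M)" "op_le 0 Z"
      using in_Z max by (auto simp: \<Z>_def)
    then have "nonneg_op (Z - on_fst M)" "nonneg_op (on_fst M - Z)" "nonneg_op Z"
      by (simp_all add: op_le_def)
    note le = this(1,2)[THEN nonneg_opD(3)] nonneg_opD(2)[OF this(3)]
    show "Z = on_fst M"
    proof (rule symm_op_eqI[OF le(3) M_symm])
      show "inner (Z z) z = inner (on_fst M z) z" for z
        using le(1,2)[of z] by (simp add: blinfun.diff_left inner_diff_left)
    qed
  qed
qed

lemma on_fst_eq_shorted_iff:
  assumes "K \<in> ops UNIV UNIV" "symm_op K"
    and "\<And>x u. inner (K (x, u)) (x, u) = inner (P x) x - 2 * inner (Y x) u + inner (R u) u"
  shows "on_fst N = shorted K (UNIV \<times> {0}) \<longleftrightarrow> N = P - inv_sandwich R Y"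
proof -
  have "N = N'" if "on_fst N = (on_fst N' :: ('h \<times> 'm) \<Rightarrow>\<^sub>L ('h \<times> 'm))" for N'
  proof (rule blinfun_eqI)
    show "N x = N' x" for x
      using arg_cong[OF that, of "\<lambda>T. T (x, 0)"] by (simp add: on_fst_def block.rep_eq)
  qed
  then show ?thesis
    using shorted_eq_schur[OF assms] by auto
qed

text \<open>On the reals \<open>INF\<close> is a genuine infimum only for families bounded below;
  the Schur complement itself provides the bound.\<close>

lemma eq_schur_iff_Inf:
  assumes "symm_op N"
  shows "N = P - inv_sandwich R Y \<longleftrightarrow>
    (\<forall>x. (INF u. inner (P x) x - 2 * inner (Y x) u + inner (R u) u - inner (N x) x) = 0)"
proof -
  define M where "M = P - inv_sandwich R Y"
  have Inf: "(INF u. inner (P x) x - 2 * inner (Y x) u + inner (R u) u - inner (N x) x)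
      = inner (M x) x - inner (N x) x" (is "?I x = _") for x
  proof (rule antisym)
    let ?f = "\<lambda>u. inner (P x) x - 2 * inner (Y x) u + inner (R u) u"
    have M_le: "inner (M x) x \<le> ?f u" for u
      using le_schur_form_iff[of "inner (M x) x" x] by (simp add: M_def)
    note diff_le = diff_right_mono[OF M_le, of "inner (N x) x"]
    show "inner (M x) x - inner (N x) x \<le> ?I x"
      by (rule cINF_greatest) (simp, rule diff_le)
    have "?I x \<le> ?f u - inner (N x) x" for u
      by (rule cINF_lower[OF bdd_belowI2[OF diff_le] UNIV_I])
    then have "\<forall>u. ?I x + inner (N x) x \<le> ?f u" by (simp add: le_diff_eq)
    then have "?I x + inner (N x) x \<le> inner (M x) x"
      unfolding M_def le_schur_form_iff .
    then show "?I x \<le> inner (M x) x - inner (N x) x" by simp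
  qed
  have "N = M \<longleftrightarrow> (\<forall>x. inner (N x) x = inner (M x) x)"
    using symm_op_eqI[OF assms, of M] schur_symm unfolding M_def by blast
  also have "\<dots> \<longleftrightarrow> (\<forall>x. ?I x = 0)"
    unfolding Inf by auto
  finally show ?thesis unfolding M_def .
qed

end

section \<open>Defect operators and the Julia operator\<close>

lemma
  assumes K: "closed_csubspace K" and T: "T \<in> ops UNIV UNIV" and le: "\<And>x. norm (T x) \<le> norm (proj K x)"
  shows nonneg_op_defect_op: "nonneg_op (defect_op K T)"
    and defect_op_square: "defect_op K T \<cdot> defect_op K T = proj K - T\<^sup>\<dagger> \<cdot> T"
    and norm_defect_op: "(norm (defect_op K T x))\<^sup>2 = (norm (proj K x))\<^sup>2 - (norm (T x))\<^sup>2"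
proof -
  have form: "inner ((proj K - T\<^sup>\<dagger> \<cdot> T) x) x = (norm (proj K x))\<^sup>2 - (norm (T x))\<^sup>2" for x
    using inner_proj[OF K, of x x]
    by (simp add: blinfun.diff_left inner_diff_left inner_adj[OF T] power2_norm_eq_inner)
  \<comment> \<open>\<open>le\<close> makes \<open>T\<close> contractive on \<open>K\<close> and
    zero on its orthogonal complement, so the extension by zero still has a nonnegative defect when
    \<open>proj K\<close> replaces the identity.\<close>
  have nn: "nonneg_op (proj K - T\<^sup>\<dagger> \<cdot> T)"
    unfolding nonneg_op_iff form
    using le by (auto intro!: ops_UNIV_intros symm_op_intros symm_op_sandwich ops_proj symm_op_proj
        ops_adj power_mono K T)
  show "nonneg_op (defect_op K T)" "defect_op K T \<cdot> defect_op K T = proj K - T\<^sup>\<dagger> \<cdot> T"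
    "(norm (defect_op K T x))\<^sup>2 = (norm (proj K x))\<^sup>2 - (norm (T x))\<^sup>2"
    unfolding defect_op_def
    by (simp_all add: nonneg_op_sqrt[OF nn] op_sqrt_square[OF nn] norm_op_sqrt[OF nn] form)
qed

context
  fixes T :: "'a::chilbert_space \<Rightarrow>\<^sub>L 'b::chilbert_space"
  assumes T: "T \<in> ops UNIV UNIV" "norm T \<le> 1"
begin

lemma contraction_defect_op:
  shows "nonneg_op (defect_op UNIV T)" "nonneg_op (defect_op UNIV (T\<^sup>\<dagger>))"
    and "defect_op UNIV T \<cdot> defect_op UNIV T = id_blinfun - T\<^sup>\<dagger> \<cdot> T"
    and "defect_op UNIV (T\<^sup>\<dagger>) \<cdot> defect_op UNIV (T\<^sup>\<dagger>) = id_blinfun - T \<cdot> T\<^sup>\<dagger>"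
    and "(norm (defect_op UNIV T x))\<^sup>2 = (norm x)\<^sup>2 - (norm (T x))\<^sup>2"
    and "(norm (defect_op UNIV (T\<^sup>\<dagger>) y))\<^sup>2 = (norm y)\<^sup>2 - (norm ((T\<^sup>\<dagger>) y))\<^sup>2"
proof -
  have "norm (T\<^sup>\<dagger>) \<le> 1" using norm_adj_le[OF T(1)] T(2) by simp
  then have le: "norm (T x) \<le> norm (proj UNIV x)" "norm ((T\<^sup>\<dagger>) y) \<le> norm (proj UNIV y)" for x y
    using norm_blinfun_le T(2) by (auto simp: proj_UNIV)
  note * = closed_csubspace_UNIV T(1) le(1)
    and ** = closed_csubspace_UNIV ops_adj[OF T(1)] le(2)
  show "nonneg_op (defect_op UNIV T)" "nonneg_op (defect_op UNIV (T\<^sup>\<dagger>))"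
    by (rule nonneg_op_defect_op[OF *] nonneg_op_defect_op[OF **])+
  show "defect_op UNIV T \<cdot> defect_op UNIV T = id_blinfun - T\<^sup>\<dagger> \<cdot> T"
    "(norm (defect_op UNIV T x))\<^sup>2 = (norm x)\<^sup>2 - (norm (T x))\<^sup>2"
    using defect_op_square[OF *] norm_defect_op[OF *] by (simp_all add: proj_UNIV)
  show "defect_op UNIV (T\<^sup>\<dagger>) \<cdot> defect_op UNIV (T\<^sup>\<dagger>) = id_blinfun - T \<cdot> T\<^sup>\<dagger>"
    "(norm (defect_op UNIV (T\<^sup>\<dagger>) y))\<^sup>2 = (norm y)\<^sup>2 - (norm ((T\<^sup>\<dagger>) y))\<^sup>2"
    using defect_op_square[OF **] norm_defect_op[OF **] by (simp_all add: proj_UNIV adj_adj[OF T(1)])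
qed

text \<open>
  The block operator \<open>J\<close> with off-diagonal entries \<open>T\<close> and \<open>T\<^sup>*\<close> commutes with the direct sum of
  the squared defect operators, hence with its square root.
\<close>

lemma defect_op_intertwine:
  shows "T (defect_op UNIV T x) = defect_op UNIV (T\<^sup>\<dagger>) (T x)"
    and "(T\<^sup>\<dagger>) (defect_op UNIV (T\<^sup>\<dagger>) y) = defect_op UNIV T ((T\<^sup>\<dagger>) y)"
proof -
  note nn = contraction_defect_op(1,2) and sq = contraction_defect_op(3,4)
  define Z where "Z = block (defect_op UNIV (T\<^sup>\<dagger>)) 0 0 (defect_op UNIV T)"
  define J where "J = block 0 T (T\<^sup>\<dagger>) 0"
  have "nonneg_op Z"
    using nonneg_opD[OF nn(1)] nonneg_opD[OF nn(2)] unfolding nonneg_op_iff Z_def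
    by (auto intro!: ops_UNIV_intros symm_op_block simp: block.rep_eq inner_prod_def)
  have sq': "defect_op UNIV T (defect_op UNIV T a) = a - (T\<^sup>\<dagger>) (T a)"
    "defect_op UNIV (T\<^sup>\<dagger>) (defect_op UNIV (T\<^sup>\<dagger>) b) = b - T ((T\<^sup>\<dagger>) b)" for a b
    using arg_cong[OF sq(1), of "\<lambda>U. U a"] arg_cong[OF sq(2), of "\<lambda>U. U b"]
    by (simp_all add: blinfun.diff_left)
  have "J \<cdot> (Z \<cdot> Z) = (Z \<cdot> Z) \<cdot> J"
    by (rule blinfun_eqI) (simp add: J_def Z_def block.rep_eq sq' blinfun.diff_right)
  moreover have "op_sqrt (Z \<cdot> Z) = Z"
    using \<open>nonneg_op Z\<close> by (rule op_sqrt_equality) simp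
  moreover have "nonneg_op (Z \<cdot> Z)"
    using \<open>nonneg_op Z\<close> by (rule nonneg_op_square)
  ultimately have "J \<cdot> Z = Z \<cdot> J"
    using op_sqrt_commute by metis
  from arg_cong[OF this, of "\<lambda>U. U (y, x)"]
  show "T (defect_op UNIV T x) = defect_op UNIV (T\<^sup>\<dagger>) (T x)"
    "(T\<^sup>\<dagger>) (defect_op UNIV (T\<^sup>\<dagger>) y) = defect_op UNIV T ((T\<^sup>\<dagger>) y)"
    by (simp_all add: J_def Z_def block.rep_eq)
qed

text \<open>The squared norms add up by the definition of the defects, and the two cross terms have
  opposite signs and equal size by intertwining.\<close>

lemma norm_julia:
  "(norm (defect_op UNIV T x - (T\<^sup>\<dagger>) y))\<^sup>2 + (norm (T x + defect_op UNIV (T\<^sup>\<dagger>) y))\<^sup>2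
    = (norm x)\<^sup>2 + (norm y)\<^sup>2"
proof -
  have "inner (defect_op UNIV T x) ((T\<^sup>\<dagger>) y) = inner (T x) (defect_op UNIV (T\<^sup>\<dagger>) y)"
    by (simp add: inner_adj[OF T(1)] defect_op_intertwine
        symm_opD[OF nonneg_opD(2)[OF contraction_defect_op(2)]])
  then show ?thesis
    unfolding norm_add_sq norm_diff_sq contraction_defect_op by simp
qed

end


section \<open>The parametrized contraction\<close>

lemma block_ops_imp:
  assumes "block A B C D \<in> ops UNIV UNIV"
  shows "A \<in> ops UNIV UNIV" "B \<in> ops UNIV UNIV" "C \<in> ops UNIV UNIV" "D \<in> ops UNIV UNIV"
proof -
  have *: "block A B C D (c *\<^sub>C z) = c *\<^sub>C block A B C D z" for c z
    using assms by (rule ops_scaleC)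
  show "A \<in> ops UNIV UNIV" "B \<in> ops UNIV UNIV" "C \<in> ops UNIV UNIV" "D \<in> ops UNIV UNIV"
    using *[of c "(x, 0)" for c x] *[of c "(0, y)" for c y]
    by (simp_all add: ops_UNIV_iff block.rep_eq scaleC_prod_def scaleC_zero_right)
qed

lemma nonneg_op_id: "nonneg_op id_blinfun"
  by (simp add: nonneg_op_iff ops_UNIV_id symm_op_intros(2))

lemma in_closure_range: "f u \<in> closure (range f)"
  using closure_subset[of "range f"] by auto

locale contraction_parametrization =
  fixes A :: "'h::chilbert_space \<Rightarrow>\<^sub>L 'h"
    and B :: "'m::chilbert_space \<Rightarrow>\<^sub>L 'h"
    and C :: "'h \<Rightarrow>\<^sub>L 'n::chilbert_space"
    and D :: "'m \<Rightarrow>\<^sub>L 'n"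
    and F :: "'m \<Rightarrow>\<^sub>L 'h"
    and G :: "'h \<Rightarrow>\<^sub>L 'n"
    and L S :: "'h \<Rightarrow>\<^sub>L 'h"
    and DD :: "'m set" and DDs :: "'n set"
  assumes T_op: "block A B C D \<in> ops UNIV UNIV" and T_contr: "norm (block A B C D) \<le> 1"
    and DD: "DD = defect_space UNIV D" and DDs: "DDs = defect_space UNIV (D\<^sup>\<dagger>)"
    and F: "F \<in> ops DD UNIV" "norm F \<le> 1"
    and G: "G \<in> ops UNIV DDs" "norm G \<le> 1"
    and L: "L \<in> ops UNIV UNIV"
    and S: "S = defect_op UNIV (F\<^sup>\<dagger>) \<cdot> L \<cdot> defect_op UNIV G"
    and A: "A = - (F \<cdot> D\<^sup>\<dagger> \<cdot> G) + S"
    and B: "B = F \<cdot> defect_op UNIV D"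
    and C: "C = defect_op UNIV (D\<^sup>\<dagger>) \<cdot> G"
begin

abbreviation T :: "('h \<times> 'm) \<Rightarrow>\<^sub>L ('h \<times> 'n)" where "T \<equiv> block A B C D"

abbreviation Q :: "('h \<times> 'm) \<Rightarrow>\<^sub>L ('h \<times> 'n)" where "Q \<equiv> block S F G 0"

lemmas ABCD_ops = block_ops_imp[OF T_op]

lemmas F_op = ops_imp_ops_UNIV[OF F(1)]
  and G_op = ops_imp_ops_UNIV[OF G(1)]

lemma norm_D: "norm D \<le> 1"
proof (rule norm_blinfun_bound)
  fix u
  have "(norm (D u))\<^sup>2 \<le> (norm (T (0, u)))\<^sup>2"
    by (simp add: block.rep_eq norm_Pair)
  then have "norm (D u) \<le> norm (T (0, u))" by (rule power2_le_imp_le) simp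
  also have "\<dots> \<le> norm (0::'h, u)" by (rule norm_blinfun_le[OF T_contr])
  finally show "norm (D u) \<le> 1 * norm u" by (simp add: norm_Pair)
qed simp

lemmas defect_D = contraction_defect_op[OF ABCD_ops(4) norm_D]
  and defect_F = contraction_defect_op[OF F_op F(2)]
  and defect_G = contraction_defect_op[OF G_op G(2)]

lemma S_op: "S \<in> ops UNIV UNIV"
  unfolding S by (intro ops_UNIV_compose L nonneg_opD(1)[OF defect_F(2)] nonneg_opD(1)[OF defect_G(1)])

lemma DD_csubspace: "closed_csubspace DD"
  unfolding DD defect_space_def
  by (rule closed_csubspace_closure_range[OF nonneg_opD(1)[OF defect_D(1)]])

text \<open>Intertwining sends the range of the defect of \<open>D\<^sup>\<dagger>\<close> into that
  of \<open>D\<close>, and continuity extends this to the closures. It keeps the substituted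
  variable inside \<open>DD\<close>.\<close>

lemma adj_D_G_in_DD: "(D\<^sup>\<dagger>) (G x) \<in> DD"
proof (rule closure_range_mapping[where f = "blinfun_apply (D\<^sup>\<dagger>)"])
  show "G x \<in> closure (range (blinfun_apply (defect_op UNIV (D\<^sup>\<dagger>))))"
    using G(1) unfolding DDs defect_space_def by (auto simp: ops_def)
  show "continuous_on UNIV (blinfun_apply (D\<^sup>\<dagger>))"
    by (intro continuous_intros)
  show "(D\<^sup>\<dagger>) (defect_op UNIV (D\<^sup>\<dagger>) y) \<in> DD" for y
    unfolding defect_op_intertwine(2)[OF ABCD_ops(4) norm_D] DD defect_space_def
    by (rule in_closure_range)
  show "closed DD" using DD_csubspace by (simp add: closed_csubspace_def)
qed

section \<open>The quadratic forms of T and Q\<close>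

definition form_T :: "('h \<Rightarrow>\<^sub>L 'h) \<Rightarrow> 'h \<Rightarrow> 'm \<Rightarrow> real"
  where "form_T X x u = (norm x)\<^sup>2 + (norm u)\<^sup>2 - (norm (op_sqrt X (A x + B u)))\<^sup>2 - (norm (C x + D u))\<^sup>2"

text \<open>The second variable should range over \<open>DD\<close>, but is allowed all of the
  space. Since \<open>F\<close> vanishes off \<open>DD\<close>, the form depends on \<open>v\<close>
  only through \<open>proj DD v\<close>, so the infimum is that over \<open>DD\<close>.\<close>

definition form_Q :: "('h \<Rightarrow>\<^sub>L 'h) \<Rightarrow> 'h \<Rightarrow> 'm \<Rightarrow> real"
  where "form_Q X x v = (norm x)\<^sup>2 + (norm (proj DD v))\<^sup>2 - (norm (op_sqrt X (S x + F v)))\<^sup>2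
    - (norm (G x))\<^sup>2"

context
  fixes X :: "'h \<Rightarrow>\<^sub>L 'h"
  assumes X: "nonneg_op X" "norm X \<le> 1"
begin

lemma norm_sqrt_X_le: "norm (op_sqrt X x) \<le> norm x"
proof (rule power2_le_imp_le)
  have "inner (X x) x \<le> norm (X x) * norm x" by (rule norm_cauchy_schwarz)
  also have "\<dots> \<le> norm x * norm x"
    by (intro mult_right_mono norm_blinfun_le X norm_ge_zero)
  finally show "(norm (op_sqrt X x))\<^sup>2 \<le> (norm x)\<^sup>2"
    by (simp only: norm_op_sqrt[OF X(1)]) (simp add: power2_eq_square)
qed simp

lemma form_T_nonneg: "0 \<le> form_T X x u"
proof -
  have "(norm (T (x, u)))\<^sup>2 \<le> (norm (x, u))\<^sup>2"
    by (intro power_mono norm_blinfun_le T_contr norm_ge_zero)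
  then have "(norm (A x + B u))\<^sup>2 + (norm (C x + D u))\<^sup>2 \<le> (norm x)\<^sup>2 + (norm u)\<^sup>2"
    by (simp add: block.rep_eq norm_Pair)
  moreover have "(norm (op_sqrt X (A x + B u)))\<^sup>2 \<le> (norm (A x + B u))\<^sup>2"
    by (intro power_mono norm_sqrt_X_le norm_ge_zero)
  ultimately show ?thesis unfolding form_T_def by linarith
qed

lemma form_T_eq_form_Q: "form_T X x u = form_Q X x (defect_op UNIV D u - (D\<^sup>\<dagger>) (G x))"
proof -
  define v where "v = defect_op UNIV D u - (D\<^sup>\<dagger>) (G x)"
  have "defect_op UNIV D u \<in> DD"
    unfolding DD defect_space_def by (rule in_closure_range)
  then have "v \<in> DD"
    using adj_D_G_in_DD DD_csubspace by (simp add: v_def closed_csubspace_def subspace_diff)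
  then have v: "proj DD v = v"
    by (rule proj_eq_self[OF DD_csubspace])
  \<comment> \<open>The term \<open>F \<cdot> D\<^sup>\<dagger> \<cdot> G\<close> of
    \<open>A\<close> is absorbed by the shift in \<open>v\<close>. The second component below and
    \<open>v\<close> are the two entries of the Julia operator of \<open>D\<close> applied to
    \<open>(u, G x)\<close>.\<close>
  have fst: "A x + B u = S x + F v"
    by (simp add: A B v_def blinfun.bilinear_simps)
  have snd: "C x + D u = D u + defect_op UNIV (D\<^sup>\<dagger>) (G x)"
    by (simp add: C)
  show ?thesis
    unfolding form_T_def form_Q_def v_def[symmetric] v fst snd
    using norm_julia[OF ABCD_ops(4) norm_D, of u "G x", folded v_def] by linarith
qed

lemma le_form_T_iff_le_form_Q: "(\<forall>u. r \<le> form_T X x u) \<longleftrightarrow> (\<forall>v. r \<le> form_Q X x v)"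
proof
  assume le: "\<forall>u. r \<le> form_T X x u"
  show "\<forall>v. r \<le> form_Q X x v"
  proof
    fix v
    \<comment> \<open>\<open>w\<close> undoes the shift, so that \<open>w\<close> minus
      \<open>(D\<^sup>\<dagger>) (G x)\<close> is \<open>proj DD v\<close>. It may fail to be of the
      form \<open>defect_op UNIV D u\<close>, but it is a limit of such vectors, and the form is
      continuous.\<close>
    define w where "w = proj DD v + (D\<^sup>\<dagger>) (G x)"
    have "w \<in> DD"
      using adj_D_G_in_DD proj_in[OF DD_csubspace] DD_csubspace
      by (simp add: w_def closed_csubspace_def subspace_add)
    then have "w \<in> closure (range (blinfun_apply (defect_op UNIV D)))"
      by (simp add: DD defect_space_def)
    moreover have "continuous_on UNIV (\<lambda>w. form_Q X x (w - (D\<^sup>\<dagger>) (G x)))"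
      unfolding form_Q_def by (intro continuous_intros)
    moreover have "form_Q X x (defect_op UNIV D u - (D\<^sup>\<dagger>) (G x)) \<in> {r..}" for u
      using le by (simp add: form_T_eq_form_Q[symmetric])
    ultimately have "form_Q X x (w - (D\<^sup>\<dagger>) (G x)) \<in> {r..}"
      by (rule closure_range_mapping) simp
    then show "r \<le> form_Q X x v"
      using proj_eq_self[OF DD_csubspace proj_in[OF DD_csubspace]]
      by (simp add: w_def form_Q_def ops_apply_proj[OF DD_csubspace F(1)])
  qed
qed (simp add: form_T_eq_form_Q)

lemma form_Q_nonneg: "0 \<le> form_Q X x v"
  using le_form_T_iff_le_form_Q[of 0 x] form_T_nonneg by blast

end

lemma form_Q_1_nonneg: "0 \<le> form_Q id_blinfun x v"
  by (rule form_Q_nonneg[OF nonneg_op_id norm_blinfun_id_le])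

lemma op_sqrt_id: "op_sqrt id_blinfun = id_blinfun"
  by (rule op_sqrt_equality[OF nonneg_op_id blinfun_compose_simps(8)])

text \<open>Q inherits contractivity from T: the inequality is the nonnegativity of
  \<open>form_Q\<close> at X = I.\<close>

lemma norm_Q_le: "norm (Q z) \<le> norm (proj (UNIV \<times> DD) z)"
proof (rule power2_le_imp_le)
  show "(norm (Q z))\<^sup>2 \<le> (norm (proj (UNIV \<times> DD) z))\<^sup>2"
    using form_Q_1_nonneg[of "fst z" "snd z"]
    by (simp add: form_Q_def op_sqrt_id proj_UNIV_Times[OF DD_csubspace] block.rep_eq norm_Pair)
qed simp

section \<open>The six equations for a fixed X\<close>

context
  fixes X :: "'h \<Rightarrow>\<^sub>L 'h"
  assumes X: "nonneg_op X" "norm X \<le> 1"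
begin

lemma inner_X: "inner (X x) y = inner (op_sqrt X x) (op_sqrt X y)"
  using symm_opD[OF nonneg_opD(2)[OF nonneg_op_sqrt[OF X(1)]], of "op_sqrt X x" y]
  by (simp add: op_sqrt_apply_twice[OF X(1)])

lemmas X_op = nonneg_opD(1)[OF X(1)]
  and X_symm = nonneg_opD(2)[OF X(1)]
  and sqrt_X_op = nonneg_opD(1)[OF nonneg_op_sqrt[OF X(1)]]
  and sqrt_X_symm = nonneg_opD(2)[OF nonneg_op_sqrt[OF X(1)]]

abbreviation "P_T \<equiv> id_blinfun - A\<^sup>\<dagger> \<cdot> X \<cdot> A - C\<^sup>\<dagger> \<cdot> C"
abbreviation "Y_T \<equiv> B\<^sup>\<dagger> \<cdot> X \<cdot> A + D\<^sup>\<dagger> \<cdot> C"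
abbreviation "R_T \<equiv> id_blinfun - B\<^sup>\<dagger> \<cdot> X \<cdot> B - D\<^sup>\<dagger> \<cdot> D"
abbreviation "P_Q \<equiv> id_blinfun - S\<^sup>\<dagger> \<cdot> X \<cdot> S - G\<^sup>\<dagger> \<cdot> G"
abbreviation "Y_Q \<equiv> F\<^sup>\<dagger> \<cdot> X \<cdot> S"
abbreviation "R_Q \<equiv> proj DD - F\<^sup>\<dagger> \<cdot> X \<cdot> F"

lemma form_T_eq: "form_T X x u = inner (P_T x) x - 2 * inner (Y_T x) u + inner (R_T u) u"
  unfolding form_T_def norm_add_sq blinfun.add_right
  by (simp add: blinfun.diff_left blinfun.add_left inner_diff_left inner_add_left
      inner_adj[OF ABCD_ops(1)] inner_adj[OF ABCD_ops(2)] inner_adj[OF ABCD_ops(3)]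
      inner_adj[OF ABCD_ops(4)] inner_X power2_norm_eq_inner)

lemma form_Q_eq: "form_Q X x v = inner (P_Q x) x - 2 * inner (Y_Q x) v + inner (R_Q v) v"
  unfolding form_Q_def norm_add_sq blinfun.add_right
  by (simp add: blinfun.diff_left inner_diff_left inner_adj[OF F_op] inner_adj[OF G_op]
      inner_adj[OF S_op] inner_X power2_norm_eq_inner inner_proj[OF DD_csubspace, of v v])

lemma schur_assms_T:
  shows "P_T \<in> ops UNIV UNIV" "symm_op P_T" "Y_T \<in> ops UNIV UNIV" "R_T \<in> ops UNIV UNIV"
    "symm_op R_T" "0 \<le> inner (P_T x) x - 2 * inner (Y_T x) u + inner (R_T u) u"
  using form_T_nonneg[OF X, of x u] unfolding form_T_eq
  by (auto intro!: ops_UNIV_intros symm_op_intros symm_op_sandwich ops_adj ABCD_ops X_op X_symm)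

lemma schur_assms_Q:
  shows "P_Q \<in> ops UNIV UNIV" "symm_op P_Q" "Y_Q \<in> ops UNIV UNIV" "R_Q \<in> ops UNIV UNIV"
    "symm_op R_Q" "0 \<le> inner (P_Q x) x - 2 * inner (Y_Q x) u + inner (R_Q u) u"
  using form_Q_nonneg[OF X, of x u] unfolding form_Q_eq
  by (auto intro!: ops_UNIV_intros symm_op_intros symm_op_sandwich ops_adj F_op G_op S_op X_op X_symm
      ops_proj symm_op_proj DD_csubspace)

lemma eq_a_iff:
  "X - A\<^sup>\<dagger> \<cdot> X \<cdot> A - C\<^sup>\<dagger> \<cdot> C - inv_sandwich R_T Y_T = 0 \<longleftrightarrow>
    id_blinfun - X = P_T - inv_sandwich R_T Y_T"
  by (auto simp: algebra_simps)

lemma eq_d_iff: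
  "X - G\<^sup>\<dagger> \<cdot> G - S\<^sup>\<dagger> \<cdot> X \<cdot> S - inv_sandwich R_Q Y_Q = 0 \<longleftrightarrow>
    id_blinfun - X = P_Q - inv_sandwich R_Q Y_Q"
  by (auto simp: algebra_simps)

lemma on_fst_op: "on_fst (id_blinfun - X) \<in> ops UNIV UNIV"
  and on_fst_symm: "symm_op (on_fst (id_blinfun - X))"
  unfolding on_fst_def by (auto intro!: ops_UNIV_intros symm_op_intros symm_op_block X_op X_symm)

lemma eq_b_iff:
  "on_fst (id_blinfun - X) =
      shorted (defect_op UNIV T \<cdot> defect_op UNIV T + T\<^sup>\<dagger> \<cdot> on_fst (id_blinfun - X) \<cdot> T) (UNIV \<times> {0})
    \<longleftrightarrow> id_blinfun - X = P_T - inv_sandwich R_T Y_T"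
proof (rule on_fst_eq_shorted_iff[OF schur_assms_T])
  note sq = contraction_defect_op(3)[OF T_op T_contr]
  show "defect_op UNIV T \<cdot> defect_op UNIV T + T\<^sup>\<dagger> \<cdot> on_fst (id_blinfun - X) \<cdot> T \<in> ops UNIV UNIV"
    "symm_op (defect_op UNIV T \<cdot> defect_op UNIV T + T\<^sup>\<dagger> \<cdot> on_fst (id_blinfun - X) \<cdot> T)"
    unfolding sq
    by (intro ops_UNIV_id ops_UNIV_add ops_UNIV_diff ops_UNIV_compose symm_op_intros symm_op_sandwich
        ops_adj T_op on_fst_op on_fst_symm)+
  show "inner ((defect_op UNIV T \<cdot> defect_op UNIV T + T\<^sup>\<dagger> \<cdot> on_fst (id_blinfun - X) \<cdot> T) (x, u)) (x, u)
      = inner (P_T x) x - 2 * inner (Y_T x) u + inner (R_T u) u" for x u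
    unfolding sq form_T_eq[symmetric] form_T_def
    by (simp add: blinfun.add_left blinfun.diff_left inner_add_left inner_diff_left inner_adj[OF T_op]
        on_fst_def block.rep_eq power2_norm_eq_inner inner_X)
qed

lemma eq_c_iff:
  "on_fst (id_blinfun - X) =
      shorted (defect_op (UNIV \<times> DD) Q \<cdot> defect_op (UNIV \<times> DD) Q
        + Q\<^sup>\<dagger> \<cdot> on_fst (id_blinfun - X) \<cdot> Q) (UNIV \<times> {0})
    \<longleftrightarrow> id_blinfun - X = P_Q - inv_sandwich R_Q Y_Q"
proof (rule on_fst_eq_shorted_iff[OF schur_assms_Q])
  note sub = closed_csubspace_Times_UNIV[OF DD_csubspace]
  have Q_op: "Q \<in> ops UNIV UNIV"
    by (intro ops_UNIV_block ops_UNIV_zero S_op F_op G_op)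
  note sq = defect_op_square[OF sub Q_op norm_Q_le]
  show "defect_op (UNIV \<times> DD) Q \<cdot> defect_op (UNIV \<times> DD) Q + Q\<^sup>\<dagger> \<cdot> on_fst (id_blinfun - X) \<cdot> Q
      \<in> ops UNIV UNIV"
    "symm_op (defect_op (UNIV \<times> DD) Q \<cdot> defect_op (UNIV \<times> DD) Q + Q\<^sup>\<dagger> \<cdot> on_fst (id_blinfun - X) \<cdot> Q)"
    unfolding sq
    by (intro ops_UNIV_add ops_UNIV_diff ops_UNIV_compose symm_op_intros symm_op_sandwich
        ops_adj Q_op on_fst_op on_fst_symm ops_proj[OF sub] symm_op_proj[OF sub])+
  show "inner ((defect_op (UNIV \<times> DD) Q \<cdot> defect_op (UNIV \<times> DD) Q
        + Q\<^sup>\<dagger> \<cdot> on_fst (id_blinfun - X) \<cdot> Q) (x, u)) (x, u)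
      = inner (P_Q x) x - 2 * inner (Y_Q x) u + inner (R_Q u) u" for x u
    unfolding sq form_Q_eq[symmetric] form_Q_def
    by (simp add: blinfun.add_left blinfun.diff_left inner_add_left inner_diff_left inner_adj[OF Q_op]
        on_fst_def block.rep_eq power2_norm_eq_inner inner_X
        proj_UNIV_Times[OF DD_csubspace] inner_proj[OF DD_csubspace, of u u])
qed

text \<open>The bridge between the equations in T and those in Q: the forms have the same lower
  bounds over their second variable, hence the same Schur complement.\<close>

lemma schur_T_eq_schur_Q: "P_T - inv_sandwich R_T Y_T = P_Q - inv_sandwich R_Q Y_Q"
proof (rule symm_op_eqI)
  show "symm_op (P_T - inv_sandwich R_T Y_T)" "symm_op (P_Q - inv_sandwich R_Q Y_Q)"
    by (rule schur_symm[OF schur_assms_T] schur_symm[OF schur_assms_Q])+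
  fix x
  have "r \<le> inner ((P_T - inv_sandwich R_T Y_T) x) x \<longleftrightarrow> r \<le> inner ((P_Q - inv_sandwich R_Q Y_Q) x) x"
    for r
    unfolding le_schur_form_iff[OF schur_assms_T] le_schur_form_iff[OF schur_assms_Q]
      form_T_eq[symmetric] form_Q_eq[symmetric]
    by (rule le_form_T_iff_le_form_Q[OF X])
  then show "inner ((P_T - inv_sandwich R_T Y_T) x) x = inner ((P_Q - inv_sandwich R_Q Y_Q) x) x"
    by (meson order_antisym order_refl)
qed

text \<open>The bracket is \<open>form_T\<close> minus the form of I - X at \<open>x\<close>. As the
  latter does not involve \<open>u\<close>, infimum zero means that the Schur complement has the
  form of I - X.\<close>

lemma eq_inf_iff:
  "(\<forall>x. (INF u. (norm (block (op_sqrt X) 0 0 id_blinfun (x, u)))\<^sup>2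
      - (norm (block (op_sqrt X) 0 0 id_blinfun (T (x, u))))\<^sup>2) = 0)
    \<longleftrightarrow> id_blinfun - X = P_T - inv_sandwich R_T Y_T"
proof -
  have "(norm (block (op_sqrt X) 0 0 id_blinfun (x, u)))\<^sup>2
      - (norm (block (op_sqrt X) 0 0 id_blinfun (T (x, u))))\<^sup>2
      = inner (P_T x) x - 2 * inner (Y_T x) u + inner (R_T u) u - inner ((id_blinfun - X) x) x" for x u
    unfolding form_T_eq[symmetric] form_T_def
    by (simp add: block.rep_eq norm_Pair blinfun.diff_left inner_diff_left inner_X
        flip: power2_norm_eq_inner)
  moreover have "symm_op (id_blinfun - X)"
    by (intro symm_op_intros X_symm)
  ultimately show ?thesis
    using eq_schur_iff_Inf[OF schur_assms_T] by simp
qed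

context
  fixes R1 :: "'h \<Rightarrow>\<^sub>L 'h"
  assumes R1: "R1 = inv_sqrt_comp (id_blinfun - op_sqrt X \<cdot> F \<cdot> F\<^sup>\<dagger> \<cdot> op_sqrt X)
    (op_sqrt X \<cdot> defect_op UNIV (F\<^sup>\<dagger>))"
begin

lemma R1_facts:
  shows "nonneg_op (id_blinfun - op_sqrt X \<cdot> F \<cdot> F\<^sup>\<dagger> \<cdot> op_sqrt X)"
    and "op_sqrt X \<cdot> defect_op UNIV (F\<^sup>\<dagger>) \<in> ops UNIV UNIV"
    and "norm (((op_sqrt X \<cdot> defect_op UNIV (F\<^sup>\<dagger>))\<^sup>\<dagger>) u)
      \<le> 1 * norm (op_sqrt (id_blinfun - op_sqrt X \<cdot> F \<cdot> F\<^sup>\<dagger> \<cdot> op_sqrt X) u)"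
    and "(0::real) \<le> 1"
    and "inner ((id_blinfun - op_sqrt X \<cdot> F \<cdot> F\<^sup>\<dagger> \<cdot> op_sqrt X) u) u
      = (norm u)\<^sup>2 - (norm ((F\<^sup>\<dagger>) (op_sqrt X u)))\<^sup>2"
proof -
  let ?R = "id_blinfun - op_sqrt X \<cdot> F \<cdot> F\<^sup>\<dagger> \<cdot> op_sqrt X"
  have form: "inner (?R u) u = (norm u)\<^sup>2 - (norm ((F\<^sup>\<dagger>) (op_sqrt X u)))\<^sup>2" for u
    by (simp add: blinfun.diff_left inner_diff_left symm_opD[OF sqrt_X_symm] power2_norm_eq_inner
        inner_adj(1)[OF F_op, symmetric])
  \<comment> \<open>The defect of \<open>F\<^sup>\<dagger>\<close> at \<open>op_sqrt X u\<close>
    replaces norm(u) by the smaller norm of \<open>op_sqrt X u\<close> in the form of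
    \<open>?R\<close>. This gives both \<open>?R\<close> nonnegative and the Douglas bound with
    constant 1.\<close>
  have defect_le: "(norm (defect_op UNIV (F\<^sup>\<dagger>) (op_sqrt X u)))\<^sup>2 \<le> inner (?R u) u" for u
    using norm_sqrt_X_le[OF X, of u] by (simp add: form defect_F power_mono)
  have "symm_op (op_sqrt X \<cdot> F \<cdot> F\<^sup>\<dagger> \<cdot> op_sqrt X)"
    by (simp add: symm_op_def symm_opD[OF sqrt_X_symm] inner_adj(1)[OF F_op, symmetric])
      (simp add: inner_adj(2)[OF F_op] symm_opD[OF sqrt_X_symm])
  then show nn: "nonneg_op ?R"
    unfolding nonneg_op_iff using order_trans[OF zero_le_power2 defect_le]
    by (auto intro!: ops_UNIV_id ops_UNIV_diff ops_UNIV_compose symm_op_intros ops_adj F_op sqrt_X_op)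
  show op: "op_sqrt X \<cdot> defect_op UNIV (F\<^sup>\<dagger>) \<in> ops UNIV UNIV"
    by (intro ops_UNIV_compose sqrt_X_op nonneg_opD(1)[OF defect_F(2)])
  have "(op_sqrt X \<cdot> defect_op UNIV (F\<^sup>\<dagger>))\<^sup>\<dagger> = defect_op UNIV (F\<^sup>\<dagger>) \<cdot> op_sqrt X"
    using op by (rule adj_eqI)
      (simp add: symm_opD[OF sqrt_X_symm] symm_opD[OF nonneg_opD(2)[OF defect_F(2)]])
  then show "norm (((op_sqrt X \<cdot> defect_op UNIV (F\<^sup>\<dagger>))\<^sup>\<dagger>) u) \<le> 1 * norm (op_sqrt ?R u)"
    using defect_le[of u] by (simp add: norm_op_sqrt[OF nn, symmetric])
  show "inner (?R u) u = (norm u)\<^sup>2 - (norm ((F\<^sup>\<dagger>) (op_sqrt X u)))\<^sup>2"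
    by (rule form)
qed simp

text \<open>
  With \<open>h = X\<^sup>1\<^sup>/\<^sup>2 D\<^bsub>F*\<^esub> y\<close> and \<open>Z = X\<^sup>1\<^sup>/\<^sup>2 F\<close>, both sides are suprema, over \<open>v\<close> respectively over \<open>a\<close>, of
  the joint supremum of \<open>2 Re \<langle>h + Z v, a\<rangle> - \<parallel>a\<parallel>\<^sup>2 - \<parallel>v\<parallel>\<^sup>2\<close>.
\<close>

lemma norm_R1:
  assumes S_y: "S x = defect_op UNIV (F\<^sup>\<dagger>) y"
  shows "(norm (R1 y))\<^sup>2 = inner (X (S x)) (S x) + (norm (inv_sqrt_comp R_Q Y_Q x))\<^sup>2"
proof -
  define h where "h = op_sqrt X (S x)"
  define Z where "Z v = op_sqrt X (F v)" for v
  have adj_Z: "inner ((F\<^sup>\<dagger>) (op_sqrt X a)) v = inner a (Z v)" for a v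
    by (simp add: Z_def inner_adj[OF F_op] symm_opD[OF sqrt_X_symm])
  have R1_le: "(norm (R1 y))\<^sup>2 \<le> r \<longleftrightarrow>
      (\<forall>a. 2 * inner h a - ((norm a)\<^sup>2 - (norm ((F\<^sup>\<dagger>) (op_sqrt X a)))\<^sup>2) \<le> r)" for r
    unfolding R1 norm_inv_sqrt_comp_le_iff[OF R1_facts(1-4)] R1_facts(5)
    by (simp add: h_def S_y)
  have W_le: "(norm (inv_sqrt_comp R_Q Y_Q x))\<^sup>2 \<le> r \<longleftrightarrow>
      (\<forall>v. 2 * inner h (Z v) - ((norm (proj DD v))\<^sup>2 - (norm (Z v))\<^sup>2) \<le> r)" for r
    unfolding norm_inv_sqrt_comp_le_iff[OF schur_facts[OF schur_assms_Q]]
    by (simp add: blinfun.diff_left inner_diff_left inner_adj[OF F_op] inner_X h_def Z_def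
        power2_norm_eq_inner inner_proj[OF DD_csubspace, of v v for v])
  have young: "2 * inner a b \<le> (norm a)\<^sup>2 + (norm b)\<^sup>2" for a b :: "'z::real_inner"
    using zero_le_power2[of "norm (a - b)"] by (simp add: norm_diff_sq)
  have "(norm (R1 y))\<^sup>2 \<le> r \<longleftrightarrow> (norm h)\<^sup>2 + (norm (inv_sqrt_comp R_Q Y_Q x))\<^sup>2 \<le> r" for r
  proof -
    \<comment> \<open>Adding norm(h)^2 completes the square: \<open>2 * inner h (Z v)\<close> and
      the squared norm of \<open>Z v\<close> merge into that of \<open>h + Z v\<close>.\<close>
    have "(norm h)\<^sup>2 + (norm (inv_sqrt_comp R_Q Y_Q x))\<^sup>2 \<le> r
        \<longleftrightarrow> (norm (inv_sqrt_comp R_Q Y_Q x))\<^sup>2 \<le> r - (norm h)\<^sup>2" by auto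
    also have "\<dots> \<longleftrightarrow> (\<forall>v. (norm (h + Z v))\<^sup>2 - (norm (proj DD v))\<^sup>2 \<le> r)"
      unfolding W_le norm_add_sq by (simp add: algebra_simps)
    also have "\<dots> \<longleftrightarrow> (norm (R1 y))\<^sup>2 \<le> r"
      unfolding R1_le
    proof (intro iffI allI)
      fix a
      assume le: "\<forall>v. (norm (h + Z v))\<^sup>2 - (norm (proj DD v))\<^sup>2 \<le> r"
      \<comment> \<open>For fixed \<open>a\<close> this \<open>v\<close> maximizes 2 Re <Z v, a> -
        norm(v)^2, with maximum norm(v)^2.\<close>
      define v where "v = (F\<^sup>\<dagger>) (op_sqrt X a)"
      have "(norm (proj DD v))\<^sup>2 \<le> (norm v)\<^sup>2"
        using young[of "proj DD v" v] inner_proj[OF DD_csubspace, of v v]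
        by (simp add: power2_norm_eq_inner)
      moreover have "inner a (Z v) = (norm v)\<^sup>2"
        by (simp add: v_def power2_norm_eq_inner flip: adj_Z)
      ultimately show "2 * inner h a - ((norm a)\<^sup>2 - (norm ((F\<^sup>\<dagger>) (op_sqrt X a)))\<^sup>2) \<le> r"
        unfolding v_def[symmetric]
        using young[of "h + Z v" a] le[rule_format, of v] inner_commute[of a "Z v"]
          inner_add_left[of h "Z v" a] by linarith
    next
      fix v
      assume le: "\<forall>a. 2 * inner h a - ((norm a)\<^sup>2 - (norm ((F\<^sup>\<dagger>) (op_sqrt X a)))\<^sup>2) \<le> r"
      \<comment> \<open>For fixed \<open>v\<close> this \<open>a\<close> maximizes 2 Re <h + Z v, a>
        - norm(a)^2.\<close>
      define a where "a = h + Z v"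
      have "inner ((F\<^sup>\<dagger>) (op_sqrt X a)) (proj DD v) = inner a (Z v)"
        unfolding adj_Z by (simp add: Z_def ops_apply_proj[OF DD_csubspace F(1)])
      then have "2 * inner a (Z v) \<le> (norm ((F\<^sup>\<dagger>) (op_sqrt X a)))\<^sup>2 + (norm (proj DD v))\<^sup>2"
        using young by metis
      moreover have "inner h a + inner a (Z v) = (norm a)\<^sup>2"
        by (simp add: a_def power2_norm_eq_inner inner_add_left inner_add_right inner_commute)
      ultimately have "(norm a)\<^sup>2 - (norm (proj DD v))\<^sup>2 \<le> r"
        using le[rule_format, of a] by linarith
      then show "(norm (h + Z v))\<^sup>2 - (norm (proj DD v))\<^sup>2 \<le> r"
        by (simp add: a_def)
    qed
    finally show ?thesis by simp
  qed
  then have "(norm (R1 y))\<^sup>2 = (norm h)\<^sup>2 + (norm (inv_sqrt_comp R_Q Y_Q x))\<^sup>2"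
    by (meson order_antisym order_refl)
  then show ?thesis
    by (simp add: h_def inner_X power2_norm_eq_inner)
qed

text \<open>The single inverse term of (e) equals the two terms of (d) that contain
  \<open>S\<close>; \<open>norm_R1\<close> at y = L D_G x is this identity on the level of quadratic
  forms.\<close>

lemma eq_e_iff:
  "X = G\<^sup>\<dagger> \<cdot> G + defect_op UNIV G \<cdot> L\<^sup>\<dagger> \<cdot> R1\<^sup>\<dagger> \<cdot> R1 \<cdot> L \<cdot> defect_op UNIV G \<longleftrightarrow>
    id_blinfun - X = P_Q - inv_sandwich R_Q Y_Q"
proof -
  have R1_op: "R1 \<in> ops UNIV UNIV"
    unfolding R1 by (rule ops_inv_sqrt_comp[OF R1_facts(1-4)])
  note symm_G = symm_opD[OF nonneg_opD(2)[OF defect_G(1)]]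
  have "defect_op UNIV G \<cdot> L\<^sup>\<dagger> \<cdot> R1\<^sup>\<dagger> \<cdot> R1 \<cdot> L \<cdot> defect_op UNIV G = S\<^sup>\<dagger> \<cdot> X \<cdot> S + inv_sandwich R_Q Y_Q"
  proof (rule symm_op_eqI)
    show "symm_op (defect_op UNIV G \<cdot> L\<^sup>\<dagger> \<cdot> R1\<^sup>\<dagger> \<cdot> R1 \<cdot> L \<cdot> defect_op UNIV G)"
      by (simp add: symm_op_def symm_G inner_adj[OF L] inner_adj[OF R1_op])
        (simp add: inner_adj[OF L] inner_adj[OF R1_op] flip: symm_G)
    show "symm_op (S\<^sup>\<dagger> \<cdot> X \<cdot> S + inv_sandwich R_Q Y_Q)"
      by (intro symm_op_intros symm_op_sandwich S_op X_symm
          symm_op_inv_sandwich[OF schur_facts[OF schur_assms_Q]])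
    fix x
    have "S x = defect_op UNIV (F\<^sup>\<dagger>) (L (defect_op UNIV G x))" by (simp add: S)
    from norm_R1[OF this]
    show "inner ((defect_op UNIV G \<cdot> L\<^sup>\<dagger> \<cdot> R1\<^sup>\<dagger> \<cdot> R1 \<cdot> L \<cdot> defect_op UNIV G) x) x
        = inner ((S\<^sup>\<dagger> \<cdot> X \<cdot> S + inv_sandwich R_Q Y_Q) x) x"
      by (simp add: symm_G inner_adj[OF L] inner_adj[OF R1_op] inner_adj[OF S_op] power2_norm_eq_inner
          blinfun.add_left inner_add_left inner_inv_sandwich[OF schur_facts[OF schur_assms_Q]])
  qed
  then show ?thesis by (auto simp: algebra_simps)
qed

end

end

end

theorem theorem6p3:
  fixes A :: "'h::chilbert_space \<Rightarrow>\<^sub>L 'h"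
    and B :: "'m::chilbert_space \<Rightarrow>\<^sub>L 'h"
    and C :: "'h \<Rightarrow>\<^sub>L 'n::chilbert_space"
    and D :: "'m \<Rightarrow>\<^sub>L 'n"
    and T :: "('h \<times> 'm) \<Rightarrow>\<^sub>L ('h \<times> 'n)"
    and F :: "'m \<Rightarrow>\<^sub>L 'h"
    and G :: "'h \<Rightarrow>\<^sub>L 'n"
    and L S :: "'h \<Rightarrow>\<^sub>L 'h"
    and Q :: "('h \<times> 'm) \<Rightarrow>\<^sub>L ('h \<times> 'n)"
    and DD :: "'m set" and DDs :: "'n set"
  assumes sep_H: "separable_space (euclidean :: 'h topology)"
    and sep_M: "separable_space (euclidean :: 'm topology)"
    and sep_N: "separable_space (euclidean :: 'n topology)"
    and T_op: "T \<in> ops UNIV UNIV" and T_contr: "norm T \<le> 1"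
    and T_block: "T = block A B C D"
    and DD: "DD = defect_space UNIV D" and DDs: "DDs = defect_space UNIV (D\<^sup>\<dagger>)"
    and F: "F \<in> ops DD UNIV" "norm F \<le> 1"
    and G: "G \<in> ops UNIV DDs" "norm G \<le> 1"
    and L: "L \<in> ops (defect_space UNIV G) (defect_space UNIV (F\<^sup>\<dagger>))" "norm L \<le> 1"
    and S: "S = defect_op UNIV (F\<^sup>\<dagger>) \<cdot> L \<cdot> defect_op UNIV G"
    and A: "A = - (F \<cdot> D\<^sup>\<dagger> \<cdot> G) + defect_op UNIV (F\<^sup>\<dagger>) \<cdot> L \<cdot> defect_op UNIV G"
    and B: "B = F \<cdot> defect_op UNIV D"
    and C: "C = defect_op UNIV (D\<^sup>\<dagger>) \<cdot> G"
    and Q: "Q = block S F G 0"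
  shows "\<forall>X \<in> op_interval.
    (let Xh = op_sqrt X;
         eq_a = (X - A\<^sup>\<dagger> \<cdot> X \<cdot> A - C\<^sup>\<dagger> \<cdot> C
           - inv_sandwich (id_blinfun - B\<^sup>\<dagger> \<cdot> X \<cdot> B - D\<^sup>\<dagger> \<cdot> D) (B\<^sup>\<dagger> \<cdot> X \<cdot> A + D\<^sup>\<dagger> \<cdot> C) = 0);
         eq_b = (on_fst (id_blinfun - X) =
           shorted (defect_op UNIV T \<cdot> defect_op UNIV T + T\<^sup>\<dagger> \<cdot> on_fst (id_blinfun - X) \<cdot> T)
             (UNIV \<times> {0}));
         eq_c = (on_fst (id_blinfun - X) =
           shorted (defect_op (UNIV \<times> DD) Q \<cdot> defect_op (UNIV \<times> DD) Q
               + Q\<^sup>\<dagger> \<cdot> on_fst (id_blinfun - X) \<cdot> Q)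
             (UNIV \<times> {0}));
         eq_d = (X - G\<^sup>\<dagger> \<cdot> G - S\<^sup>\<dagger> \<cdot> X \<cdot> S
           - inv_sandwich (proj DD - F\<^sup>\<dagger> \<cdot> X \<cdot> F) (F\<^sup>\<dagger> \<cdot> X \<cdot> S) = 0);
         R1 = inv_sqrt_comp (id_blinfun - Xh \<cdot> F \<cdot> F\<^sup>\<dagger> \<cdot> Xh) (Xh \<cdot> defect_op UNIV (F\<^sup>\<dagger>));
         eq_e = (X = G\<^sup>\<dagger> \<cdot> G + defect_op UNIV G \<cdot> L\<^sup>\<dagger> \<cdot> R1\<^sup>\<dagger> \<cdot> R1 \<cdot> L \<cdot> defect_op UNIV G);
         eq_inf = (\<forall>x. (INF u. (norm (block Xh 0 0 id_blinfun (x, u)))\<^sup>2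
                           - (norm (block Xh 0 0 id_blinfun (T (x, u))))\<^sup>2) = 0)
     in ((eq_a \<longleftrightarrow> eq_b) \<and> (eq_b \<longleftrightarrow> eq_c) \<and> (eq_c \<longleftrightarrow> eq_d) \<and> (eq_d \<longleftrightarrow> eq_e)) \<and>
        (eq_b \<longleftrightarrow> eq_inf) \<and> (eq_c \<longleftrightarrow> eq_inf) \<and> (eq_d \<longleftrightarrow> eq_inf) \<and> (eq_e \<longleftrightarrow> eq_inf))"
proof (rule ballI, goal_cases)
  case (1 X)
  then have X: "nonneg_op X" "norm X \<le> 1" by (auto simp: op_interval_def)
  interpret contraction_parametrization A B C D F G L S DD DDs
    by unfold_locales
      (use T_op T_contr T_block DD DDs F G ops_imp_ops_UNIV[OF L(1)] S A B C in \<open>simp_all\<close>)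
  \<comment> \<open>Each of the six equations becomes I - X = the common Schur complement;
    \<open>refl\<close> supplies the definition of \<open>R1\<close>.\<close>
  show ?case
    unfolding Let_def T_block Q eq_b_iff[OF X] eq_c_iff[OF X]
      eq_a_iff[OF X] eq_d_iff[OF X] eq_e_iff[OF X refl] eq_inf_iff[OF X]
      schur_T_eq_schur_Q[OF X]
    by blast
qed

end
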